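(* Let $F,G,I,S,j_a,j_b,a_e,b_o$ be as in the context, where $F(x)=x^{n+1}+\sum_{k=0}^{n}b_kx^k$ and $G(x)=-Ax^m-\sum_{k=0}^{m-1}a_kx^k$ satisfy $F(0)=F'(0)=0$, $F'(x)/x>0$ for all $x\in\mathbb R$, $G(0)=0$, $G(x)/x<0$ for all $x\in\mathbb R$, and at least one of $j_a$ and $j_b$ is well-defined. Assume that $m=2n+1$. Then $I(y)$ converges to a real number $I_*$ as $y\to+\infty$. Moreover: 1. When $I_*<0$ (resp. $I_*>0$), for each $y_0$ sufficiently large, the orbit $U$ of $y_0$ by $S$ (resp. $S^{-1}$) tends to $+\infty$ and $\dim_BU=0$. 2. Suppose that ($n-2j_b<2n+1-2j_a$ or $a_e=0$) and $I_*=0$. Then, for each $y_0$ sufficiently large, the orbit $U$ of $y_0$ by $S$ (resp. $S^{-1}$) tends to $+\infty$ for $b_{2j_b+1}<0$ (resp. $b_{2j_b+1}>0$), $U$ is Minkowski nondegenerate and $\dim_BU=\frac{n-2j_b}{n+1-2j_b}$. 3. Suppose that ($n-2j_b>2n+1-2j_a$ or $b_o=0$) and $I_*=0$. Then, for each $y_0$ sufficiently large, the orbit $U$ of $y_0$ by $S$ (resp. $S^{-1}$) tends to $+\infty$ for $a_{2j_a}>0$ (resp. $a_{2j_a}<0$), $U$ is Minkowski nondegenerate and $\dim_BU=\frac{2n+1-2j_a}{2n+2-2j_a}$. 4. Suppose that $n-2j_b=2n+1-2j_a$, $C:=b_{2j_b+1}(n+2j_b+2)-a_{2j_a}\frac{n+1}{A}\neq0$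 and $I_*=0$. Then, for each $y_0$ sufficiently large, the orbit $U$ of $y_0$ by $S$ (resp. $S^{-1}$) tends to $+\infty$ for $C<0$ (resp. $C>0$), $U$ is Minkowski nondegenerate and $\dim_BU=\frac{n-2j_b}{n+1-2j_b}$.
   Context: Setting. Consider the slow-fast Liénard system $\dot x=y-F(x)$, $\dot y=\epsilon G(x)$, $0\le\epsilon\ll1$, where $F(x)=x^{n+1}+\sum_{k=0}^{n}b_kx^k$ and $G(x)=-Ax^m-\sum_{k=0}^{m-1}a_kx^k$ are real polynomials, $m,n\ge1$ integers, and $A\ne0$ (when $m=2n+1$). The assumptions $F(0)=F'(0)=0$, $F'(x)/x>0$ for all $x\in\mathbb R$, $G(0)=0$, $G(x)/x<0$ for all $x\in\mathbb R$ are understood with $F'(x)/x$ and $G(x)/x$ regarded as polynomials (so also at $x=0$, i.e. $F''(0)>0$, $G'(0)<0$). They imply that $m$ and $n$ are odd, $b_0=b_1=a_0=0$ and $A>0$. Slow divergence integrals. For $y>0$ let $\omega(y)>0$ and $\alpha(y)<0$ be the unique numbers with $F(\omega(y))=F(\alpha(y))=y$ (and $\omega(0)=\alpha(0)=0$). Put $$I_-(y)=-\int_{\omega(y)}^{0}\frac{F'(x)^2}{G(x)}\,dx,\qquad I_+(y)=-\int_{\alpha(y)}^{0}\frac{F'(x)^2}{G(x)}\,dx,\qquad I(y)=I_-(y)-I_+(y).$$ The functions $I_\pm$ are strictly decreasing with $I_\pm(0)=0$, and, for $m\le 2n+1$, $I_\pm(y)\to-\infty$ as $y\to+\infty$. Slow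 relation function. $S:[0,\infty)\to[0,\infty)$ is defined by $I_-(y)=I_+(S(y))$, and $S^{-1}$ is its inverse. The orbit of $y_0>0$ by $S$ is $U=\{y_l=S^l(y_0)\mid l\in\mathbb N\}$ ($S^l$ the $l$-fold composition); the orbit by $S^{-1}$ is defined in the same way with $S^{-1}$ in place of $S$. "$U$ tends to $+\infty$" means $y_l\to+\infty$ as $l\to\infty$. "For each $y_0$ sufficiently large" means: there is $M>0$ such that the assertion holds for every $y_0>M$. Coefficients. If some odd-index coefficient $b_{2j+1}$ ($0\le j\le\frac{n-1}{2}$) of $F$ is nonzero, $j_b$ is the maximal $j$ with $b_{2j+1}\neq0$; otherwise $j_b$ is not defined and we write $b_o=0$. If some even-index coefficient $a_{2j}$ ($0\le j\le\frac{m-1}{2}$) is nonzero, $j_a$ is the maximal $j$ with $a_{2j}\neq0$; otherwise $j_a$ is not defined and we write $a_e=0$. A condition comparing $n-2j_b$ with $2n+1-2j_a$ presupposes that both $j_a$ and $j_b$ are defined. Minkowski dimension. For bounded $V\subset\mathbb R$ and $\delta>0$ let $V_\delta=\{x\in\mathbb R\mid d(x,V)\le\delta\}$ with Lebesgue measure $|V_\delta|$. For $s\ge0$ put $\mathcal M_*^s(V)=\liminf_{\delta\to0}|V_\delta|/\delta^{1-s}$ and $\mathcal M^{*s}(V)=\limsup_{\delta\to0}|V_\delta|/\delta^{1-s}$. The lower and upper Minkowski dimensions are $\underline{\dim}_BV=\inf\{s\ge0\mid\mathcal M_*^s(V)=0\}$, $\overline{\dim}_BV=\inf\{s\ge0\mid\mathcal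 M^{*s}(V)=0\}$; if equal, the common value is $\dim_BV$. $V$ is Minkowski nondegenerate if $0<\mathcal M_*^d(V)\le\mathcal M^{*d}(V)<\infty$ for some $d$ (then $d=\dim_BV$). For an orbit $U=\{y_l\}$ with $y_l\to+\infty$ and $m\le2n+1$, the lower and upper Minkowski dimensions of $U$ are by definition those of the bounded set $\{y_l^{-1/(n+1)}\mid l\in\mathbb N\}$, $\dim_BU$ is their common value when they agree, and $U$ is called Minkowski nondegenerate if $\{y_l^{-1/(n+1)}\mid l\in\mathbb N\}$ is. *)

theory Defs
  imports "HOL-Analysis.Analysis" "HOL-Computational_Algebra.Polynomial"
begin

section \<open>Slow divergence integrals and the slow relation function\<close>

definition omega :: "real poly \<Rightarrow> real \<Rightarrow> real" where
  "omega F y = (if y = 0 then 0 else (THE x. 0 < x \<and> poly F x = y))"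

definition alpha :: "real poly \<Rightarrow> real \<Rightarrow> real" where
  "alpha F y = (if y = 0 then 0 else (THE x. x < 0 \<and> poly F x = y))"

text \<open>
  The integrals are oriented. The integrand is \<open>0 / 0 = 0\<close> at the end point \<open>x = 0\<close>, which
  is also its limit there.
\<close>

definition I_minus :: "real poly \<Rightarrow> real poly \<Rightarrow> real \<Rightarrow> real" where
  "I_minus F G y = - (LBINT x = ereal (omega F y)..0. (poly (pderiv F) x)\<^sup>2 / poly G x)"

definition I_plus :: "real poly \<Rightarrow> real poly \<Rightarrow> real \<Rightarrow> real" where
  "I_plus F G y = - (LBINT x = ereal (alpha F y)..0. (poly (pderiv F) x)\<^sup>2 / poly G x)"

definition slow_div_int :: "real poly \<Rightarrow> real poly \<Rightarrow> real \<Rightarrow> real" where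
  "slow_div_int F G y = I_minus F G y - I_plus F G y"

definition slow_rel :: "real poly \<Rightarrow> real poly \<Rightarrow> real \<Rightarrow> real" where
  "slow_rel F G y = (THE z. 0 \<le> z \<and> I_minus F G y = I_plus F G z)"

definition slow_rel_inv :: "real poly \<Rightarrow> real poly \<Rightarrow> real \<Rightarrow> real" where
  "slow_rel_inv F G = the_inv_into {0..} (slow_rel F G)"

definition orbit_seq :: "(real \<Rightarrow> real) \<Rightarrow> real \<Rightarrow> nat \<Rightarrow> real" where
  "orbit_seq T y0 l = (T ^^ l) y0"

section \<open>The indices of the leading odd and even coefficients\<close>

text \<open>
  \<open>j_b\<close> and \<open>j_a\<close> are meaningful only under \<open>j_b_defined\<close> and \<open>j_a_defined\<close>; the negations of
  these predicates are the conditions \<open>b\<^sub>o = 0\<close> and \<open>a\<^sub>e = 0\<close>.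
\<close>

definition j_b_defined :: "nat \<Rightarrow> (nat \<Rightarrow> real) \<Rightarrow> bool" where
  "j_b_defined n b \<longleftrightarrow> (\<exists>j. 2 * j + 1 \<le> n \<and> b (2 * j + 1) \<noteq> 0)"

definition j_b :: "nat \<Rightarrow> (nat \<Rightarrow> real) \<Rightarrow> nat" where
  "j_b n b = Max {j. 2 * j + 1 \<le> n \<and> b (2 * j + 1) \<noteq> 0}"

definition j_a_defined :: "nat \<Rightarrow> (nat \<Rightarrow> real) \<Rightarrow> bool" where
  "j_a_defined m a \<longleftrightarrow> (\<exists>j. 2 * j + 1 \<le> m \<and> a (2 * j) \<noteq> 0)"

definition j_a :: "nat \<Rightarrow> (nat \<Rightarrow> real) \<Rightarrow> nat" where
  "j_a m a = Max {j. 2 * j + 1 \<le> m \<and> a (2 * j) \<noteq> 0}"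

section \<open>Minkowski dimension of subsets of the line\<close>

definition nbhd :: "real set \<Rightarrow> real \<Rightarrow> real set" where
  "nbhd V \<delta> = {x. infdist x V \<le> \<delta>}"

definition lower_mink_content :: "real \<Rightarrow> real set \<Rightarrow> ereal" where
  "lower_mink_content s V =
     Liminf (at_right 0) (\<lambda>\<delta>. ereal (measure lebesgue (nbhd V \<delta>) / \<delta> powr (1 - s)))"

definition upper_mink_content :: "real \<Rightarrow> real set \<Rightarrow> ereal" where
  "upper_mink_content s V =
     Limsup (at_right 0) (\<lambda>\<delta>. ereal (measure lebesgue (nbhd V \<delta>) / \<delta> powr (1 - s)))"

definition lower_mink_dim :: "real set \<Rightarrow> real" where
  "lower_mink_dim V = Inf {s. 0 \<le> s \<and> lower_mink_content s V = 0}"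

definition upper_mink_dim :: "real set \<Rightarrow> real" where
  "upper_mink_dim V = Inf {s. 0 \<le> s \<and> upper_mink_content s V = 0}"

definition has_mink_dim :: "real set \<Rightarrow> real \<Rightarrow> bool" where
  "has_mink_dim V d \<longleftrightarrow> lower_mink_dim V = d \<and> upper_mink_dim V = d"

definition mink_nondegenerate :: "real set \<Rightarrow> bool" where
  "mink_nondegenerate V \<longleftrightarrow>
     (\<exists>d\<ge>0. 0 < lower_mink_content d V \<and> lower_mink_content d V \<le> upper_mink_content d V
           \<and> upper_mink_content d V < \<infinity>)"

text \<open>
  An orbit tending to infinity is measured through the bounded set of the
  \<open>y\<^sub>l powr (- 1 / (n + 1))\<close>.
\<close>

definition compactified_orbit :: "nat \<Rightarrow> (nat \<Rightarrow> real) \<Rightarrow> real set" where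
  "compactified_orbit n y = range (\<lambda>l. y l powr (- 1 / (real n + 1)))"

definition orbit_has_dim :: "nat \<Rightarrow> (nat \<Rightarrow> real) \<Rightarrow> real \<Rightarrow> bool" where
  "orbit_has_dim n y d \<longleftrightarrow> has_mink_dim (compactified_orbit n y) d"

definition orbit_nondegenerate :: "nat \<Rightarrow> (nat \<Rightarrow> real) \<Rightarrow> bool" where
  "orbit_nondegenerate n y \<longleftrightarrow> mink_nondegenerate (compactified_orbit n y)"

definition for_all_suff_large :: "(real \<Rightarrow> bool) \<Rightarrow> bool" where
  "for_all_suff_large P \<longleftrightarrow> (\<exists>M>0. \<forall>y0>M. P y0)"

definition escapes_with_dim :: "nat \<Rightarrow> (nat \<Rightarrow> real) \<Rightarrow> real \<Rightarrow> bool" where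
  "escapes_with_dim n y d \<longleftrightarrow> filterlim y at_top sequentially \<and> orbit_has_dim n y d"

definition escapes_nondegenerately :: "nat \<Rightarrow> (nat \<Rightarrow> real) \<Rightarrow> real \<Rightarrow> bool" where
  "escapes_nondegenerately n y d \<longleftrightarrow>
     filterlim y at_top sequentially \<and> orbit_nondegenerate n y \<and> orbit_has_dim n y d"

end

theory Submission
  imports Defs
begin

text \<open>
  Let \<open>f = F'\<^sup>2 / G\<close> and let \<open>\<Phi>\<close> be its antiderivative with \<open>\<Phi> 0 = 0\<close>, so that the slow divergence
  integrals are \<open>\<Phi> (\<omega> y)\<close> and \<open>\<Phi> (\<alpha> y)\<close>. Since \<open>m = 2 n + 1\<close>, both behave like
  \<open>- (n + 1) / A * ln y\<close>, hence \<open>I_plus (S y) - I_plus y = I y\<close> says that \<open>ln (S y / y)\<close> is comparable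
  to \<open>- I y\<close>. If \<open>I\<close> tends to a negative limit, the orbit grows at least geometrically and its
  compactification has dimension 0. If the limit is 0, the leading odd coefficient of \<open>F\<close> and the leading
  even coefficient of \<open>G\<close> give \<open>I y \<sim> c * \<rho> powr (- q)\<close> with \<open>\<rho> = y powr (1 / (n + 1))\<close>; then
  \<open>\<rho> ^ q\<close> grows by increments bounded from above and from below along the orbit, so the points
  \<open>1 / \<rho>\<close> are distributed like \<open>l powr (- 1 / q)\<close>, which has Minkowski dimension \<open>q / (q + 1)\<close>.
  The orbits of \<open>S\<close> inverse are treated alike, with \<open>I_minus\<close> and \<open>I_plus\<close> exchanged.
\<close>

section \<open>Minkowski dimension of monotone sequences\<close>

text \<open>For even \<open>F\<close> and odd \<open>G\<close> the two branches are mirror images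
  and \<open>I\<close> vanishes, so \<open>I\<close> measures the asymmetry caused by odd
  coefficients of \<open>F\<close> and even coefficients of \<open>G\<close>. Relative to the
  leading terms, \<open>F\<close> contributes first at order \<open>q = n - 2 * j_b\<close> and
  \<open>G\<close> at order \<open>q = 2 * n + 1 - 2 * j_a\<close>. Both numbers are odd; the
  smaller one governs \<open>I\<close>, and in a tie the contributions add up to a positive multiple
  of \<open>C\<close>. The orbit is known only implicitly, through an equation between two
  integrals. No expansion of \<open>S\<close> is attempted: nondegenerate content asks only for
  two-sided bounds with unspecified constants, and bounds on \<open>ln (S y / y)\<close> suffice for
  these along the whole orbit. Likewise the limit of \<open>I\<close> is never computed, only shown
  to exist together with a rate.\<close>

lemma closed_nbhd: "closed (nbhd V \<delta>)"
proof -
  have "closed ((\<lambda>x. infdist x V) -` {..\<delta>})"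
    by (intro closed_vimage continuous_on_infdist continuous_on_id) auto
  thus ?thesis by (simp add: nbhd_def vimage_def)
qed

text \<open>\<open>V\<close> need not be closed, so the infimum behind \<open>infdist\<close> may
  not be attained; doubling \<delta> leaves room for a genuine point of \<open>V\<close> and costs
  only a constant factor.\<close>

lemma nbhd_near:
  assumes "V \<noteq> {}" "\<delta> > 0" "x \<in> nbhd V \<delta>"
  obtains v where "v \<in> V" "\<bar>x - v\<bar> < 2 * \<delta>"
proof -
  have "infdist x V < 2 * \<delta>" using assms by (simp add: nbhd_def)
  hence "(INF v\<in>V. dist x v) < 2 * \<delta>" using assms(1) by (simp add: infdist_def)
  hence "\<exists>v\<in>V. dist x v < 2 * \<delta>"
    using assms(1) by (subst (asm) cINF_less_iff) (auto intro!: bdd_belowI2[of _ 0])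
  thus ?thesis using that by (auto simp: dist_real_def)
qed

lemma nbhd_lmeasurable:
  assumes "V \<noteq> {}" "bounded V" "\<delta> > 0"
  shows "nbhd V \<delta> \<in> lmeasurable"
proof -
  obtain B where B: "\<And>v. v \<in> V \<Longrightarrow> \<bar>v\<bar> \<le> B"
    using assms(2) by (auto simp: bounded_iff)
  have "nbhd V \<delta> \<subseteq> {-(B + 2*\<delta>)..B + 2*\<delta>}"
  proof
    fix x assume "x \<in> nbhd V \<delta>"
    then obtain v where "v \<in> V" "\<bar>x - v\<bar> < 2 * \<delta>" using nbhd_near assms by metis
    with B[of v] show "x \<in> {-(B + 2*\<delta>)..B + 2*\<delta>}" by auto
  qed
  hence "bounded (nbhd V \<delta>)" by (meson bounded_closed_interval bounded_subset)
  thus ?thesis using closed_nbhd lmeasurable_compact compact_eq_bounded_closed by blast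
qed

text \<open>The set is split at a threshold \<open>X\<close>: the part in \<open>{0..X}\<close> is
  covered by one interval of length \<open>X + 4 * \<delta>\<close>, each of the finitely many other
  points by one of length \<open>4 * \<delta>\<close>.\<close>

lemma measure_nbhd_le:
  assumes "V \<noteq> {}" "bounded V" "V \<subseteq> {0..X} \<union> S" "finite S" "real (card S) \<le> N" "X \<ge> 0" "\<delta> > 0"
  shows "measure lebesgue (nbhd V \<delta>) \<le> X + 4 * \<delta> + 4 * \<delta> * N"
proof -
  define W where "W = (\<Union>s\<in>S. {s - 2*\<delta>..s + 2*\<delta>})"
  have sub: "nbhd V \<delta> \<subseteq> {-2*\<delta>..X + 2*\<delta>} \<union> W"
  proof
    fix x assume "x \<in> nbhd V \<delta>"
    then obtain v where v: "v \<in> V" "\<bar>x - v\<bar> < 2 * \<delta>" using nbhd_near assms by metis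
    with assms(3) have "v \<in> {0..X} \<or> v \<in> S" by auto
    thus "x \<in> {-2*\<delta>..X + 2*\<delta>} \<union> W"
    proof
      assume "v \<in> S"
      thus ?thesis using v(2) by (auto simp: W_def intro!: bexI[of _ v])
    qed (use v(2) in auto)
  qed
  have Wm: "W \<in> lmeasurable" unfolding W_def using assms(4) by (intro fmeasurable.finite_UN) auto
  have "measure lebesgue (nbhd V \<delta>) \<le> measure lebesgue ({-2*\<delta>..X + 2*\<delta>} \<union> W)"
    using sub nbhd_lmeasurable[OF assms(1,2,7)] Wm
    by (intro measure_mono_fmeasurable) (auto intro!: fmeasurable.Un)
  also have "\<dots> \<le> measure lebesgue {-2*\<delta>..X + 2*\<delta>} + measure lebesgue W"
    using Wm by (intro measure_Un_le) auto
  also have "measure lebesgue W \<le> (\<Sum>s\<in>S. measure lebesgue {s - 2*\<delta>..s + 2*\<delta>})"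
    unfolding W_def using assms(4) by (intro measure_UNION_le) auto
  also have "\<dots> = 4 * \<delta> * card S" using assms(7) by simp
  also have "\<dots> \<le> 4 * \<delta> * N" using assms(5,7) by simp
  finally show ?thesis using assms(6,7) by simp
qed

text \<open>Passing from exponent \<open>d\<close> to \<open>s\<close> multiplies the content ratio
  by \<open>\<delta> powr (s - d)\<close>, which for small \<delta> is at least 1 if
  \<open>s \<le> d\<close> and tends to 0 if \<open>s > d\<close>. The nonnegative exponents with
  zero content are therefore exactly those above \<open>d\<close>, for lower and upper content
  alike.\<close>

lemma has_mink_dimI_powr:
  assumes c: "0 < c" and d: "0 \<le> d"
    and ev: "eventually (\<lambda>\<delta>. c * \<delta> powr (1 - d) \<le> measure lebesgue (nbhd V \<delta>) \<and>
                measure lebesgue (nbhd V \<delta>) \<le> K * \<delta> powr (1 - d)) (at_right 0)"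
  shows "mink_nondegenerate V" "has_mink_dim V d"
proof -
  define r where "r s \<delta> = measure lebesgue (nbhd V \<delta>) / \<delta> powr (1 - s)" for s \<delta>
  have pos: "eventually (\<lambda>\<delta>::real. 0 < \<delta> \<and> \<delta> < 1) (at_right 0)"
    using eventually_at_right_real[of 0 1] by simp
  have bnd: "eventually (\<lambda>\<delta>. c \<le> r d \<delta> \<and> r d \<delta> \<le> K) (at_right 0)"
    using ev pos by eventually_elim (auto simp: r_def field_simps)
  have r_eq: "r s \<delta> = r d \<delta> * \<delta> powr (s - d)" if "\<delta> > 0" for s \<delta>
  proof -
    have "\<delta> powr (1 - d) = \<delta> powr (1 - s) * \<delta> powr (s - d)" by (simp add: powr_add [symmetric])
    thus ?thesis using that by (simp add: r_def)
  qed
  have le: "lower_mink_content s V \<le> upper_mink_content s V" for s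
    unfolding lower_mink_content_def upper_mink_content_def by (intro Liminf_le_Limsup) simp
  have low: "ereal c \<le> lower_mink_content s V" if "s \<le> d" for s
    unfolding lower_mink_content_def
  proof (rule Liminf_bounded)
    show "eventually (\<lambda>\<delta>. ereal c \<le> ereal (measure lebesgue (nbhd V \<delta>) / \<delta> powr (1 - s))) (at_right 0)"
      using bnd pos
    proof eventually_elim
      case (elim \<delta>)
      have "1 \<le> \<delta> powr (s - d)"
        using powr_mono'[of "s - d" 0 \<delta>] elim that by simp
      hence "c * 1 \<le> r d \<delta> * \<delta> powr (s - d)" using elim c by (intro mult_mono) auto
      thus ?case using r_eq[of \<delta> s] elim by (simp add: r_def)
    qed
  qed
  have upK: "upper_mink_content d V \<le> ereal K"
    unfolding upper_mink_content_def
    by (rule Limsup_bounded) (use bnd in eventually_elim, auto simp: r_def)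
  have up0: "upper_mink_content s V = 0 \<and> lower_mink_content s V = 0" if "s > d" for s
  proof -
    have "((\<lambda>\<delta>. K * \<delta> powr (s - d)) \<longlongrightarrow> K * 0) (at_right 0)"
      using that by (intro tendsto_mult tendsto_const tendsto_zero_powrI[where b = "s - d"] tendsto_ident_at)
         (auto simp: eventually_at_right_less eventually_at_filter)
    hence lim: "((\<lambda>\<delta>. K * \<delta> powr (s - d)) \<longlongrightarrow> 0) (at_right 0)" by simp
    have "(r s \<longlongrightarrow> 0) (at_right 0)"
    proof (rule tendsto_sandwich[OF _ _ tendsto_const lim])
      show "eventually (\<lambda>\<delta>. 0 \<le> r s \<delta>) (at_right 0)" by (simp add: r_def)
      show "eventually (\<lambda>\<delta>. r s \<delta> \<le> K * \<delta> powr (s - d)) (at_right 0)"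
        using bnd pos
      proof eventually_elim
        case (elim \<delta>)
        thus ?case using r_eq[of \<delta> s] by (simp add: mult_right_mono)
      qed
    qed
    hence *: "((\<lambda>\<delta>. ereal (r s \<delta>)) \<longlongrightarrow> ereal 0) (at_right 0)" by simp
    show ?thesis unfolding upper_mink_content_def lower_mink_content_def r_def[symmetric]
      using lim_imp_Limsup[OF _ *] lim_imp_Liminf[OF _ *] by (simp add: zero_ereal_def)
  qed
  have cpos: "0 < ereal c" using c by simp
  show "mink_nondegenerate V" unfolding mink_nondegenerate_def
    using less_le_trans[OF cpos low[of d]] le[of d] le_less_trans[OF upK, of \<infinity>] d
    by (intro exI[of _ d]) auto
  have nz: "lower_mink_content s V \<noteq> 0" "upper_mink_content s V \<noteq> 0" if "s \<le> d" for s
    using less_le_trans[OF cpos low[OF that]] le[of s] by auto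
  have "0 \<le> s \<and> lower_mink_content s V = 0 \<longleftrightarrow> d < s"
       "0 \<le> s \<and> upper_mink_content s V = 0 \<longleftrightarrow> d < s" for s
    using up0[of s] nz[of s] d by (cases "d < s"; simp)+
  hence "{s. 0 \<le> s \<and> lower_mink_content s V = 0} = {d<..}"
        "{s. 0 \<le> s \<and> upper_mink_content s V = 0} = {d<..}"
    by auto
  thus "has_mink_dim V d" by (simp add: has_mink_dim_def lower_mink_dim_def upper_mink_dim_def)
qed

lemma has_mink_dim_0I:
  assumes "\<And>s. s > 0 \<Longrightarrow>
     ((\<lambda>\<delta>. measure lebesgue (nbhd V \<delta>) / \<delta> powr (1 - s)) \<longlongrightarrow> 0) (at_right 0)"
  shows "has_mink_dim V 0"
proof -
  have *: "upper_mink_content s V = 0 \<and> lower_mink_content s V = 0" if "s > 0" for s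
  proof -
    have *: "((\<lambda>\<delta>. ereal (measure lebesgue (nbhd V \<delta>) / \<delta> powr (1 - s))) \<longlongrightarrow> ereal 0) (at_right 0)"
      using assms[OF that] by simp
    show ?thesis unfolding upper_mink_content_def lower_mink_content_def
      using lim_imp_Limsup[OF _ *] lim_imp_Liminf[OF _ *] by (simp add: zero_ereal_def)
  qed
  \<comment> \<open>The content at exponent 0 is left open: whether or not 0 belongs to the set, the
    infimum is 0.\<close>
  have "Inf A = 0" if "{0<..} \<subseteq> A" "A \<subseteq> {0..}" for A :: "real set"
  proof -
    have "A = {0<..} \<or> A = {0..}" using that by (cases "0 \<in> A") (force simp: order_le_less)+
    thus ?thesis by auto
  qed
  thus ?thesis unfolding has_mink_dim_def lower_mink_dim_def upper_mink_dim_def using *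
    by (intro conjI) (auto simp: subset_iff)
qed

lemma power_growth_sequence:
  fixes \<rho> :: "nat \<Rightarrow> real"
  assumes q: "q \<ge> 1" and c1: "c1 > 0" and pos: "\<And>l. \<rho> l > 0"
    and inc: "\<And>l. c1 \<le> \<rho> (Suc l) ^ q - \<rho> l ^ q"
  shows "\<rho> 0 ^ q + c1 * real l \<le> \<rho> l ^ q" "strict_mono \<rho>" "\<exists>l. B < \<rho> l"
proof -
  show lin: "\<rho> 0 ^ q + c1 * real l \<le> \<rho> l ^ q" for l
  proof (induction l)
    case (Suc l)
    thus ?case using inc[of l] by (simp add: algebra_simps)
  qed simp
  show "strict_mono \<rho>"
  proof (rule strict_monoI_Suc)
    fix l
    have "\<rho> l ^ q < \<rho> (Suc l) ^ q" using inc[of l] c1 by linarith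
    thus "\<rho> l < \<rho> (Suc l)" using pos[of "Suc l"] power_less_imp_less_base[of "\<rho> l" q] by simp
  qed
  obtain l :: nat where l: "(\<bar>B\<bar> ^ q) / c1 < real l" using reals_Archimedean2 by blast
  hence "\<bar>B\<bar> ^ q < c1 * real l" using c1 by (simp add: field_simps)
  also have "\<dots> \<le> \<rho> l ^ q" using lin[of l] zero_less_power[OF pos[of 0], of q] by linarith
  finally have "\<bar>B\<bar> < \<rho> l" using pos[of l] power_less_imp_less_base[of "\<bar>B\<bar>" q] by simp
  thus "\<exists>l. B < \<rho> l" by (intro exI[of _ l]) auto
qed

lemma strict_mono_bracket:
  fixes \<rho> :: "nat \<Rightarrow> real"
  assumes "\<exists>l. B < \<rho> l" "\<rho> 0 \<le> B"
  obtains l where "\<rho> l \<le> B" "B < \<rho> (Suc l)"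
proof -
  define k where "k = (LEAST l. B < \<rho> l)"
  have k: "B < \<rho> k" unfolding k_def using assms(1) by (rule LeastI_ex)
  with assms(2) obtain l where l: "k = Suc l" by (cases k) auto
  have "\<not> B < \<rho> l" using not_less_Least[of l "\<lambda>l. B < \<rho> l"] l k_def by simp
  thus ?thesis using that[of l] k l by simp
qed

text \<open>Near \<open>x\<close> consecutive points \<open>1 / \<rho> l\<close> are at distance of
  order at most \<open>x ^ Suc q\<close>, so \<open>\<delta> = t ^ Suc q\<close> puts the crossover
  at scale \<open>t\<close>. Below \<open>c * t\<close> the gaps are at most \<delta> and the
  neighbourhood contains an interval; above \<open>t\<close> there are at most
  \<open>1 / (c1 * t ^ q) + 1\<close> points, each costing \<open>4 * \<delta>\<close>. Both parts
  have measure of order \<open>t\<close>. The constant \<open>M\<close> bounds the ratio of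
  successive terms of \<rho>.\<close>

lemma nbhd_measure_bounds_power_growth:
  fixes \<rho> :: "nat \<Rightarrow> real"
  assumes q: "q \<ge> 1" and c1: "c1 > 0" and pos: "\<And>l. \<rho> l > 0"
    and inc: "\<And>l. c1 \<le> \<rho> (Suc l) ^ q - \<rho> l ^ q" "\<And>l. \<rho> (Suc l) ^ q - \<rho> l ^ q \<le> c2"
  defines "M \<equiv> 1 + c2 / \<rho> 0 ^ q"
  defines "V \<equiv> range (\<lambda>l. 1 / \<rho> l)"
  defines "c \<equiv> 1 / (M * (c2 + 1))"
  assumes t: "0 < t" "t \<le> 1" "c * t \<le> 1 / \<rho> 0"
  shows "c > 0" "c * t \<le> measure lebesgue (nbhd V (t ^ Suc q))"
        "measure lebesgue (nbhd V (t ^ Suc q)) \<le> (9 + 4 / c1) * t"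
proof -
  note growth = power_growth_sequence[where \<rho> = \<rho>, OF q c1 pos inc(1)]
  define \<delta> where "\<delta> = t ^ Suc q"
  have \<delta>: "\<delta> > 0" "\<delta> \<le> t" using t(1,2) power_decreasing[of 1 "Suc q" t] by (simp_all add: \<delta>_def)
  have c2: "c2 > 0" using inc[of 0] c1 by linarith
  have M: "M \<ge> 1" using c2 pos[of 0] by (simp add: M_def)
  show c: "c > 0" using M c2 by (simp add: c_def)
  have V: "V \<noteq> {}" "bounded V"
  proof -
    have "V \<subseteq> {0..1 / \<rho> 0}"
      using growth(2) pos by (auto simp: V_def less_imp_le frac_le strict_mono_less_eq)
    thus "V \<noteq> {}" "bounded V" by (auto simp: V_def intro: bounded_subset[OF bounded_closed_interval])
  qed
  have "{0<..c * t} \<subseteq> nbhd V \<delta>"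
  proof
    fix x assume "x \<in> {0<..c * t}"
    hence x: "0 < x" "x \<le> c * t" by auto
    have "x \<le> 1 / \<rho> 0" using x t(3) by linarith
    hence "\<rho> 0 \<le> 1 / x" using x pos[of 0] by (simp add: field_simps)
    then obtain l where l: "\<rho> l \<le> 1 / x" "1 / x < \<rho> (Suc l)"
      using strict_mono_bracket growth(3) by metis
    obtain k where k: "q = Suc k" using q by (cases q) auto
    have le: "\<rho> l < \<rho> (Suc l)" using growth(2) by (simp add: strict_mono_def)
    have ge0: "\<rho> 0 \<le> \<rho> l" using growth(2) by (simp add: strict_mono_less_eq)
    \<comment> \<open>The additive bound \<open>c2\<close> becomes the factor \<open>M\<close>
      because \<open>\<rho> l\<close> is at least \<open>\<rho> 0\<close>. Hence
      \<open>1 / \<rho> l\<close> is at most \<open>M * x\<close>, wherever in the gap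
      \<open>x\<close> lies.\<close>
    have "\<rho> (Suc l) ^ q \<le> \<rho> l ^ q + c2" using inc(2)[of l] by linarith
    also have "\<dots> \<le> \<rho> l ^ q + c2 * (\<rho> l ^ q / \<rho> 0 ^ q)"
      using c2 pos[of 0] power_mono[OF ge0, of q] by (simp add: field_simps)
    also have "\<dots> = M * \<rho> l ^ q" using pos[of 0] by (simp add: M_def field_simps)
    also have "\<dots> \<le> M ^ q * \<rho> l ^ q"
      using M q pos[of l] self_le_power[of M q] by (intro mult_right_mono) auto
    finally have "\<rho> (Suc l) ^ q \<le> (M * \<rho> l) ^ q" by (simp add: power_mult_distrib)
    hence ratio: "\<rho> (Suc l) \<le> M * \<rho> l"
      using M pos[of l] q by (subst (asm) power_mono_iff) (auto simp: less_imp_le pos)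
    have inv: "1 / \<rho> l \<le> M * x"
    proof -
      have "1 / x < M * \<rho> l" using ratio l(2) by linarith
      thus ?thesis using x pos[of l] by (simp add: field_simps)
    qed
    \<comment> \<open>Splitting one factor off the difference of \<open>q\<close>-th powers bounds
      the plain difference of neighbours by \<open>c2 / \<rho> l ^ k\<close>.\<close>
    have "(\<rho> (Suc l) - \<rho> l) * \<rho> l ^ k \<le> \<rho> (Suc l) ^ q - \<rho> l ^ q"
      using power_mono[of "\<rho> l" "\<rho> (Suc l)" k] le pos[of l] pos[of "Suc l"]
      by (simp add: k algebra_simps)
    hence gap: "(\<rho> (Suc l) - \<rho> l) * \<rho> l ^ k \<le> c2" using inc(2)[of l] by linarith
    have "x - 1 / \<rho> (Suc l) \<le> 1 / \<rho> l - 1 / \<rho> (Suc l)" using l(1) x pos[of l] by (simp add: field_simps)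
    also have "\<dots> = ((\<rho> (Suc l) - \<rho> l) * \<rho> l ^ k) / (\<rho> l ^ q * \<rho> (Suc l))"
      using pos[of l] pos[of "Suc l"] by (simp add: k field_simps)
    also have "\<dots> \<le> c2 / (\<rho> l ^ q * \<rho> l)"
      using gap le pos[of l] pos[of "Suc l"] c2 by (intro frac_le mult_left_mono) auto
    also have "\<dots> = c2 * (1 / \<rho> l) ^ Suc q" by (simp add: power_divide)
    also have "\<dots> \<le> c2 * (M * x) ^ Suc q"
      using c2 inv pos[of l] by (intro mult_left_mono power_mono) auto
    also have "\<dots> \<le> c2 * (M * (c * t)) ^ Suc q"
      using c2 x M by (intro mult_left_mono power_mono) auto
    also have "M * (c * t) = t / (c2 + 1)" using M by (simp add: c_def)
    also have "c2 * (t / (c2 + 1)) ^ Suc q = (c2 / (c2 + 1) ^ Suc q) * \<delta>"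
      by (simp only: power_divide \<delta>_def) simp
    also have "\<dots> \<le> 1 * \<delta>"
    proof (intro mult_right_mono)
      \<comment> \<open>The \<open>+ 1\<close> in the definition of \<open>c\<close> makes the
        estimate work also for \<open>c2 < 1\<close>, where \<open>c2 ^ Suc q\<close> would fall
        below \<open>c2\<close>.\<close>
      have "c2 + 1 \<le> (c2 + 1) ^ Suc q" using c2 by (intro self_le_power) auto
      hence "c2 \<le> (c2 + 1) ^ Suc q" by linarith
      thus "c2 / (c2 + 1) ^ Suc q \<le> 1" using c2 by (simp del: power_Suc)
    qed (use \<delta> in auto)
    finally have "dist x (1 / \<rho> (Suc l)) \<le> \<delta>"
      using l(2) x pos[of "Suc l"] by (simp add: dist_real_def field_simps)
    thus "x \<in> nbhd V \<delta>"
      by (auto simp: nbhd_def V_def intro: order_trans[OF infdist_le])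
  qed
  hence "measure lebesgue {0<..c * t} \<le> measure lebesgue (nbhd V \<delta>)"
    using nbhd_lmeasurable[OF V \<delta>(1)] by (intro measure_mono_fmeasurable) auto
  thus "c * t \<le> measure lebesgue (nbhd V (t ^ Suc q))" using c t by (simp add: \<delta>_def)

  define S where "S = (\<lambda>l. 1 / \<rho> l) ` {l. t < 1 / \<rho> l}"
  define N where "N = nat \<lceil>1 / (c1 * t ^ q)\<rceil>"
  have sub: "{l. t < 1 / \<rho> l} \<subseteq> {..<N}"
  proof safe
    fix l assume "t < 1 / \<rho> l"
    hence "\<rho> l < 1 / t" using t pos[of l] by (simp add: field_simps)
    hence "\<rho> l ^ q < (1 / t) ^ q" using q pos[of l] by (intro power_strict_mono) auto
    moreover have "c1 * real l \<le> \<rho> l ^ q" using growth(1)[of l] zero_less_power[OF pos[of 0], of q] by linarith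
    ultimately have "c1 * real l < (1 / t) ^ q" by linarith
    hence "real l < 1 / (c1 * t ^ q)" using c1 t by (simp add: field_simps power_divide)
    thus "l < N" unfolding N_def by linarith
  qed
  have "card S \<le> card {l. t < 1 / \<rho> l}" unfolding S_def
    by (rule card_image_le) (use sub finite_subset in blast)
  also have "\<dots> \<le> card {..<N}" by (rule card_mono) (use sub in auto)
  finally have "real (card S) \<le> real N" by simp
  also have "\<dots> \<le> 1 / (c1 * t ^ q) + 1" unfolding N_def using c1 t by simp
  finally have card: "real (card S) \<le> 1 / (c1 * t ^ q) + 1" .
  have "V \<subseteq> {0..t} \<union> S" using pos by (auto simp: V_def S_def less_imp_le)
  moreover have "finite S" unfolding S_def using sub finite_subset by blast
  ultimately have "measure lebesgue (nbhd V \<delta>) \<le> t + 4 * \<delta> + 4 * \<delta> * (1 / (c1 * t ^ q) + 1)"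
    using V card t \<delta> by (intro measure_nbhd_le) auto
  also have "\<dots> = t + 8 * \<delta> + 4 / c1 * t" using c1 t by (simp add: \<delta>_def field_simps)
  also have "\<dots> \<le> (9 + 4 / c1) * t" using \<delta> by (simp add: algebra_simps)
  finally show "measure lebesgue (nbhd V (t ^ Suc q)) \<le> (9 + 4 / c1) * t" by (simp add: \<delta>_def)
qed

lemma mink_power_growth:
  fixes \<rho> :: "nat \<Rightarrow> real"
  assumes q: "q \<ge> 1" and c1: "c1 > 0" and pos: "\<And>l. \<rho> l > 0"
    and inc: "\<And>l. c1 \<le> \<rho> (Suc l) ^ q - \<rho> l ^ q" "\<And>l. \<rho> (Suc l) ^ q - \<rho> l ^ q \<le> c2"
  shows "mink_nondegenerate (range (\<lambda>l. 1 / \<rho> l))"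
        "has_mink_dim (range (\<lambda>l. 1 / \<rho> l)) (real q / (real q + 1))"
proof -
  define M where "M = 1 + c2 / \<rho> 0 ^ q"
  define c where "c = 1 / (M * (c2 + 1))"
  define V where "V = range (\<lambda>l. 1 / \<rho> l)"
  define e where "e = 1 / (real q + 1)"
  have e: "1 - real q / (real q + 1) = e" "e > 0" by (auto simp: e_def field_simps)
  have c2: "c2 > 0" using inc[of 0] c1 by linarith
  have c: "c > 0" using c2 pos[of 0] by (auto simp: c_def M_def intro!: mult_pos_pos add_pos_pos)
  \<comment> \<open>Below this threshold \<open>t = \<delta> powr e\<close> satisfies both size
    conditions of the preceding lemma, \<open>t \<le> 1\<close> and
    \<open>c * t \<le> 1 / \<rho> 0\<close>.\<close>
  define t0 where "t0 = min 1 (1 / \<rho> 0 / c)"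
  have t0: "t0 > 0" using c pos[of 0] by (simp add: t0_def)
  have "eventually (\<lambda>\<delta>. \<delta> \<in> {0<..<t0 powr (1 / e)}) (at_right 0)"
    using t0 by (intro eventually_at_right_real) auto
  hence ev: "eventually (\<lambda>\<delta>. c * \<delta> powr e \<le> measure lebesgue (nbhd V \<delta>) \<and>
                measure lebesgue (nbhd V \<delta>) \<le> (9 + 4 / c1) * \<delta> powr e) (at_right 0)"
  proof eventually_elim
    case (elim \<delta>)
    define t where "t = \<delta> powr e"
    have "t \<le> (t0 powr (1 / e)) powr e" unfolding t_def using elim e by (intro powr_mono2) auto
    also have "\<dots> = t0" using e t0 by (simp add: powr_powr)
    finally have "t \<le> t0" .
    hence t: "0 < t" "t \<le> 1" "c * t \<le> 1 / \<rho> 0"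
      using elim c pos[of 0] by (auto simp: t_def t0_def field_simps)
    have "t ^ Suc q = \<delta>" using elim
      by (simp add: t_def powr_realpow[symmetric] powr_powr e_def add.commute del: power_Suc)
    thus ?case using nbhd_measure_bounds_power_growth(2,3)[where \<rho> = \<rho>, OF q c1 pos inc, of t] t
      by (simp add: c_def M_def V_def t_def del: power_Suc)
  qed
  show "mink_nondegenerate (range (\<lambda>l. 1 / \<rho> l))"
        "has_mink_dim (range (\<lambda>l. 1 / \<rho> l)) (real q / (real q + 1))"
    using has_mink_dimI_powr[OF c, where d = "real q / (real q + 1)" and K = "9 + 4 / c1" and V = V] ev
    unfolding e(1) by (auto simp: V_def)
qed

text \<open>Only logarithmically many points exceed \<delta>. Bounding the logarithm by the power
  \<open>\<delta> powr (-e)\<close> with \<open>e = s / 2\<close> leaves a measure of order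
  \<open>\<delta> powr (1 - e)\<close>, negligible against
  \<open>\<delta> powr (1 - s)\<close>.\<close>

lemma has_mink_dim_geometric:
  fixes \<rho> :: "nat \<Rightarrow> real"
  assumes lam: "\<mu> > 1" and pos: "\<And>l. \<rho> l > 0" and grow: "\<And>l. \<mu> * \<rho> l \<le> \<rho> (Suc l)"
  shows "has_mink_dim (range (\<lambda>l. 1 / \<rho> l)) 0"
proof (rule has_mink_dim_0I)
  fix s :: real assume s: "s > 0"
  define V where "V = range (\<lambda>l. 1 / \<rho> l)"
  have lin: "\<mu> ^ l * \<rho> 0 \<le> \<rho> l" for l
  proof (induction l)
    case (Suc l)
    have "\<mu> ^ Suc l * \<rho> 0 \<le> \<mu> * \<rho> l" using Suc lam by simp
    thus ?case using grow[of l] by linarith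
  qed simp
  have V: "V \<noteq> {}" "bounded V"
  proof -
    have "\<rho> 0 \<le> \<rho> l" for l
    proof -
      have "1 * \<rho> 0 \<le> \<mu> ^ l * \<rho> 0" using lam pos[of 0] by (intro mult_right_mono) auto
      thus ?thesis using lin[of l] by simp
    qed
    hence "V \<subseteq> {0..1 / \<rho> 0}" using pos by (auto simp: V_def less_imp_le frac_le)
    thus "V \<noteq> {}" "bounded V" by (auto simp: V_def intro: bounded_subset[OF bounded_closed_interval])
  qed
  define e where "e = s / 2"
  \<comment> \<open>Collects the constants of \<open>ln u \<le> u powr e / e\<close> at
    \<open>u = 1 / (\<delta> * \<rho> 0)\<close>, divided by \<open>ln \<mu>\<close>.\<close>
  define K where "K = \<rho> 0 powr (-e) / (e * ln \<mu>)"
  have e: "e > 0" using s by (simp add: e_def)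
  have lnl: "ln \<mu> > 0" using lam by simp
  have K: "K > 0" using e lnl pos[of 0] by (simp add: K_def)
  have bound: "measure lebesgue (nbhd V \<delta>) \<le> \<delta> + 4 * \<delta> + 4 * \<delta> * (K * \<delta> powr (-e) + 1)" if "\<delta> > 0" for \<delta>
  proof -
    define S where "S = (\<lambda>l. 1 / \<rho> l) ` {l. \<delta> < 1 / \<rho> l}"
    define N where "N = nat \<lceil>K * \<delta> powr (-e)\<rceil>"
    have sub: "{l. \<delta> < 1 / \<rho> l} \<subseteq> {..<N}"
    proof safe
      fix l assume l: "\<delta> < 1 / \<rho> l"
      hence "\<rho> l < 1 / \<delta>" using that pos[of l] by (simp add: field_simps)
      hence "\<mu> ^ l * \<rho> 0 < 1 / \<delta>" using lin[of l] by linarith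
      hence lz: "\<mu> ^ l < 1 / (\<delta> * \<rho> 0)" using pos[of 0] that by (simp add: field_simps)
      moreover have "1 \<le> \<mu> ^ l" using lam by simp
      ultimately have z: "1 \<le> 1 / (\<delta> * \<rho> 0)" by linarith
      have "real l * ln \<mu> = ln (\<mu> ^ l)" using lam by (simp add: ln_realpow)
      also have "\<dots> < ln (1 / (\<delta> * \<rho> 0))" using lz lam that pos[of 0] by (subst ln_less_cancel_iff) auto
      also have "\<dots> \<le> (1 / (\<delta> * \<rho> 0)) powr e / e" using z e by (rule ln_powr_bound)
      also have "(1 / (\<delta> * \<rho> 0)) powr e = \<delta> powr (-e) * \<rho> 0 powr (-e)"
        using that pos[of 0] by (simp add: powr_divide powr_mult powr_minus_divide)
      finally have "real l < K * \<delta> powr (-e)" using e lnl by (simp add: K_def field_simps)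
      thus "l < N" unfolding N_def by linarith
    qed
    have "card S \<le> card {l. \<delta> < 1 / \<rho> l}" unfolding S_def
      by (rule card_image_le) (use sub finite_subset in blast)
    also have "\<dots> \<le> card {..<N}" by (rule card_mono) (use sub in auto)
    finally have "real (card S) \<le> real N" by simp
    also have "\<dots> \<le> K * \<delta> powr (-e) + 1" unfolding N_def using K by simp
    finally have card: "real (card S) \<le> K * \<delta> powr (-e) + 1" .
    have "V \<subseteq> {0..\<delta>} \<union> S" using pos by (auto simp: V_def S_def less_imp_le)
    moreover have "finite S" unfolding S_def using sub finite_subset by blast
    ultimately show ?thesis using V card that by (intro measure_nbhd_le) auto
  qed
  have tend: "((\<lambda>\<delta>::real. \<delta> powr a) \<longlongrightarrow> 0) (at_right 0)" if "a > 0" for a :: real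
    using that by (intro tendsto_zero_powrI[where b = a] tendsto_ident_at tendsto_const)
       (auto simp: eventually_at_right_less eventually_at_filter)
  have "((\<lambda>\<delta>. 9 * \<delta> powr s + 4 * K * \<delta> powr e) \<longlongrightarrow> 9 * 0 + 4 * K * 0) (at_right 0)"
    using s e by (intro tendsto_intros tend) auto
  hence lim: "((\<lambda>\<delta>. 9 * \<delta> powr s + 4 * K * \<delta> powr e) \<longlongrightarrow> 0) (at_right 0)" by simp
  have "((\<lambda>\<delta>. measure lebesgue (nbhd V \<delta>) / \<delta> powr (1 - s)) \<longlongrightarrow> 0) (at_right 0)"
  proof (rule tendsto_sandwich[OF _ _ tendsto_const lim])
    show "eventually (\<lambda>\<delta>. measure lebesgue (nbhd V \<delta>) / \<delta> powr (1 - s) \<le> 9 * \<delta> powr s + 4 * K * \<delta> powr e) (at_right 0)"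
      using eventually_at_right_less
    proof eventually_elim
      case (elim \<delta>)
      have 1: "\<delta> = \<delta> powr s * \<delta> powr (1 - s)" using elim by (simp add: powr_add[symmetric])
      have 2: "\<delta> * \<delta> powr (-e) = \<delta> powr e * \<delta> powr (1 - s)"
        using elim by (simp add: powr_mult_base powr_add[symmetric] e_def)
      have "measure lebesgue (nbhd V \<delta>) \<le> 9 * \<delta> + 4 * K * (\<delta> * \<delta> powr (-e))"
        using bound[OF elim] by (simp add: algebra_simps)
      also have "\<dots> = 9 * (\<delta> powr s * \<delta> powr (1 - s)) + 4 * K * (\<delta> powr e * \<delta> powr (1 - s))"
        unfolding 2 1[symmetric] ..
      also have "\<dots> = (9 * \<delta> powr s + 4 * K * \<delta> powr e) * \<delta> powr (1 - s)"
        by (simp add: algebra_simps)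
      finally show ?case using elim by (simp add: pos_divide_le_eq)
    qed
  qed simp
  thus "((\<lambda>\<delta>. measure lebesgue (nbhd (range (\<lambda>l. 1 / \<rho> l)) \<delta>) / \<delta> powr (1 - s)) \<longlongrightarrow> 0) (at_right 0)"
    by (simp add: V_def)
qed

section \<open>Orbits of the slow relation\<close>

lemma power_growth_at_top:
  fixes \<rho> :: "nat \<Rightarrow> real"
  assumes "q \<ge> 1" "c1 > 0" "\<And>l. \<rho> l > 0" "\<And>l. c1 \<le> \<rho> (Suc l) ^ q - \<rho> l ^ q"
  shows "filterlim \<rho> at_top sequentially"
  unfolding filterlim_at_top
proof
  fix Z
  note g = power_growth_sequence[where \<rho> = \<rho>, OF assms]
  obtain l0 where "Z < \<rho> l0" using g(3) by blast
  moreover have "\<rho> l0 \<le> \<rho> l" if "l0 \<le> l" for l using that g(2) by (simp add: strict_mono_less_eq)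
  ultimately show "eventually (\<lambda>l. Z \<le> \<rho> l) sequentially"
    unfolding eventually_sequentially by (meson less_imp_le order_trans)
qed

text \<open>
  Both \<open>S\<close> and its inverse are instances: \<open>(J1, J2)\<close> is \<open>(I_minus, I_plus)\<close> for the former and
  \<open>(I_plus, I_minus)\<close> for the latter.
\<close>

locale log_regular_relation =
  fixes J1 J2 T :: "real \<Rightarrow> real" and K1 K2 M0 :: real
  assumes K: "K1 > 0" "K2 > 0"
    and log_bounds: "\<And>y z. M0 \<le> y \<Longrightarrow> y \<le> z \<Longrightarrow>
        K1 * (ln z - ln y) \<le> J2 y - J2 z \<and> J2 y - J2 z \<le> K2 * (ln z - ln y)"
    and J2_anti: "\<And>y z. 0 \<le> y \<Longrightarrow> y \<le> z \<Longrightarrow> J2 z \<le> J2 y"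
    and T: "\<And>y. 0 \<le> y \<Longrightarrow> 0 \<le> T y \<and> J2 (T y) = J1 y"
begin

text \<open>The equation \<open>J2 (T y) = J1 y\<close> makes \<open>J2 y - J1 y\<close> the
  decrement of \<open>J2\<close> from \<open>y\<close> to \<open>T y\<close>. The logarithmic bounds
  are then read backwards, so \<open>K2\<close> yields the lower estimate and \<open>K1\<close> the
  upper one.\<close>

lemma step:
  assumes "0 < y" "M0 \<le> y" "J1 y < J2 y"
  shows "y < T y" "(J2 y - J1 y) / K2 \<le> ln (T y) - ln y" "ln (T y) - ln y \<le> (J2 y - J1 y) / K1"
proof -
  have Ty: "0 \<le> T y" "J2 (T y) = J1 y" using T[of y] assms by auto
  show "y < T y"
  proof (rule ccontr)
    assume "\<not> y < T y"
    hence "J2 y \<le> J2 (T y)" using J2_anti[of "T y" y] Ty by simp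
    thus False using Ty assms(3) by simp
  qed
  with log_bounds[of y "T y"] Ty assms(2) K
  show "(J2 y - J1 y) / K2 \<le> ln (T y) - ln y" "ln (T y) - ln y \<le> (J2 y - J1 y) / K1"
    by (auto simp: field_simps)
qed

lemma orbit_large:
  assumes "\<And>y. y > M \<Longrightarrow> y < T y" "y0 > M"
  shows "orbit_seq T y0 l > M"
  by (induction l) (use assms in \<open>auto simp: orbit_seq_def intro: less_trans\<close>)

end

lemma powr_root_ln_diff:
  assumes "0 < y" "0 < (z :: real)"
  shows "z powr r = y powr r * exp (r * (ln z - ln y))"
  using assms by (simp add: powr_def exp_add[symmetric] algebra_simps)

lemma compactified_orbit_inverse:
  assumes "\<And>l. y l > 0"
  shows "compactified_orbit n y = range (\<lambda>l. 1 / y l powr (1 / (real n + 1)))"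
  using assms by (simp add: compactified_orbit_def powr_minus_divide)

lemma filterlim_from_powr_at_top:
  fixes y :: "nat \<Rightarrow> real"
  assumes "\<And>l. y l > 0" "filterlim (\<lambda>l. y l powr (1 / (real n + 1))) at_top sequentially"
  shows "filterlim y at_top sequentially"
proof -
  have "filterlim (\<lambda>l. (y l powr (1 / (real n + 1))) ^ Suc n) at_top sequentially"
    by (rule filterlim_pow_at_top[OF _ assms(2)]) simp
  moreover have "(y l powr (1 / (real n + 1))) ^ Suc n = y l" for l
    using assms(1)[of l] by (simp add: powr_realpow[symmetric] powr_powr add.commute del: power_Suc)
  ultimately show ?thesis by simp
qed

context log_regular_relation
begin

lemma escapes_with_dim_0:
  assumes lim: "((\<lambda>y. J1 y - J2 y) \<longlongrightarrow> L) at_top" and L: "L < 0"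
  shows "for_all_suff_large (\<lambda>y0. escapes_with_dim n (orbit_seq T y0) 0)"
proof -
  have "eventually (\<lambda>y. J1 y - J2 y < L / 2) at_top" using lim L by (intro order_tendstoD) auto
  then obtain M1 where M1: "\<And>y. y \<ge> M1 \<Longrightarrow> J1 y - J2 y < L / 2" by (auto simp: eventually_at_top_linorder)
  define M where "M = max 1 (max M0 M1)"
  define r where "r = 1 / (real n + 1)"
  \<comment> \<open>Eventually \<open>J2 y - J1 y\<close> exceeds \<open>- L / 2\<close>, so each
    step multiplies \<open>y powr r\<close> by at least \<mu>.\<close>
  define \<mu> where "\<mu> = exp (r * (- L / 2 / K2))"
  have rpos: "r > 0" by (simp add: r_def)
  have "r * (- L / 2 / K2) > 0" using K L by (intro mult_pos_pos divide_pos_pos) (auto simp: r_def)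
  hence mu: "\<mu> > 1" by (simp add: \<mu>_def)
  have neg: "J1 y < J2 y" if "y > M" for y using M1[of y] L that by (simp add: M_def)
  have up: "y < T y" if "y > M" for y using step(1)[of y] neg[OF that] that by (simp add: M_def)
  have grow: "\<mu> * y powr r \<le> T y powr r" if "y > M" for y
  proof -
    have y: "0 < y" "M0 \<le> y" "M1 \<le> y" using that by (auto simp: M_def)
    have "- L / 2 / K2 \<le> (J2 y - J1 y) / K2" using M1[OF y(3)] K by (intro divide_right_mono) auto
    also have "\<dots> \<le> ln (T y) - ln y" using step(2)[of y] y neg[OF that] by simp
    finally have "r * (- L / 2 / K2) \<le> r * (ln (T y) - ln y)" using rpos by (intro mult_left_mono) auto
    hence "\<mu> \<le> exp (r * (ln (T y) - ln y))" by (simp add: \<mu>_def)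
    thus ?thesis using powr_root_ln_diff[of y "T y" r] y up[OF that]
      by (simp add: mult.commute mult_left_mono)
  qed
  have "escapes_with_dim n (orbit_seq T y0) 0" if y0: "y0 > M" for y0
  proof -
    define y where "y = orbit_seq T y0"
    define \<rho> where "\<rho> l = y l powr r" for l
    have y: "y l > M" for l unfolding y_def using orbit_large up y0 by blast
    have ypos: "y l > 0" for l using y[of l] by (simp add: M_def)
    have rpos: "\<rho> l > 0" for l using ypos[of l] by (simp add: \<rho>_def)
    have g: "\<mu> * \<rho> l \<le> \<rho> (Suc l)" for l using grow[OF y, of l] by (simp add: \<rho>_def y_def orbit_seq_def)
    have r1: "\<rho> l \<ge> 1" for l using y[of l] by (auto simp: \<rho>_def r_def M_def intro!: ge_one_powr_ge_zero)
    \<comment> \<open>Since \<open>\<rho> l \<ge> 1\<close>, geometric growth implies increments of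
      at least \<open>\<mu> - 1\<close>, and the power growth criterion with \<open>q = 1\<close>
      gives divergence.\<close>
    have "\<mu> - 1 \<le> \<rho> (Suc l) ^ 1 - \<rho> l ^ 1" for l
    proof -
      have "(\<mu> - 1) * 1 \<le> (\<mu> - 1) * \<rho> l" using mu r1 by (intro mult_left_mono) auto
      thus ?thesis using g[of l] by (simp add: algebra_simps)
    qed
    hence "filterlim \<rho> at_top sequentially" using mu rpos by (intro power_growth_at_top[of 1 "\<mu> - 1"]) auto
    hence "filterlim (\<lambda>l. y l powr (1 / (real n + 1))) at_top sequentially"
      unfolding \<rho>_def[abs_def] r_def .
    hence "filterlim y at_top sequentially" by (rule filterlim_from_powr_at_top[OF ypos])
    moreover have "has_mink_dim (compactified_orbit n y) 0"
      using has_mink_dim_geometric[of \<mu> \<rho>] mu rpos g ypos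
      by (simp add: compactified_orbit_inverse \<rho>_def r_def)
    ultimately show ?thesis by (simp add: escapes_with_dim_def orbit_has_dim_def y_def)
  qed
  thus ?thesis unfolding for_all_suff_large_def by (intro exI[of _ M]) (auto simp: M_def)
qed

text \<open>With \<open>R = (y powr r) ^ q\<close> and \<open>z = q * r * (ln (T y) - ln y)\<close>,
  one step adds \<open>R * (exp z - 1)\<close> to \<open>R\<close>. The limit hypothesis confines
  \<open>R * z\<close> to the interval from \<open>c1\<close> to \<open>D\<close>; then
  \<open>z \<le> exp z - 1 \<le> z * exp z\<close> and \<open>z \<le> D\<close> confine the
  increment to the interval from \<open>c1\<close> to \<open>D * exp D\<close>.\<close>

lemma escapes_nondegenerately_power:
  assumes lim: "((\<lambda>y. (J1 y - J2 y) * (y powr (1 / (real n + 1))) ^ q) \<longlongrightarrow> \<kappa>) at_top"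
    and neg: "\<kappa> < 0" and q: "q \<ge> 1"
  shows "for_all_suff_large (\<lambda>y0. escapes_nondegenerately n (orbit_seq T y0) (real q / (real q + 1)))"
proof -
  define r where "r = 1 / (real n + 1)"
  have r: "r > 0" by (simp add: r_def)
  have "eventually (\<lambda>y. (J1 y - J2 y) * (y powr r) ^ q < \<kappa> / 2) at_top"
       "eventually (\<lambda>y. (J1 y - J2 y) * (y powr r) ^ q > 2 * \<kappa>) at_top"
    using order_tendstoD(1)[OF lim, of "2 * \<kappa>"] order_tendstoD(2)[OF lim, of "\<kappa> / 2"] neg
    by (simp_all add: r_def mult.commute)
  hence "eventually (\<lambda>y. (J1 y - J2 y) * (y powr r) ^ q < \<kappa> / 2 \<and> (J1 y - J2 y) * (y powr r) ^ q > 2 * \<kappa>) at_top"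
    by eventually_elim auto
  then obtain M1 where M1: "\<And>y. y \<ge> M1 \<Longrightarrow>
      (J1 y - J2 y) * (y powr r) ^ q < \<kappa> / 2 \<and> (J1 y - J2 y) * (y powr r) ^ q > 2 * \<kappa>"
    by (auto simp: eventually_at_top_linorder)
  define M where "M = max 1 (max M0 M1)"
  \<comment> \<open>\<open>c1\<close> combines the eventual bound \<open>\<kappa> / 2\<close> with
    \<open>K2\<close>, and \<open>D\<close> the bound \<open>2 * \<kappa>\<close> with
    \<open>K1\<close>; the signs are reversed because \<kappa> is negative.\<close>
  define c1 where "c1 = q * r * (- \<kappa> / 2 / K2)"
  define D where "D = q * r * (- 2 * \<kappa> / K1)"
  have c1: "c1 > 0" unfolding c1_def using K neg q r by (intro mult_pos_pos divide_pos_pos) auto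
  have sgn: "J1 y < J2 y" if "y > M" for y
  proof -
    have "(J1 y - J2 y) * (y powr r) ^ q < 0" using M1[of y] neg that by (simp add: M_def)
    thus ?thesis by (simp add: mult_less_0_iff)
  qed
  have up: "y < T y" if "y > M" for y using step(1)[of y] sgn[OF that] that by (simp add: M_def)
  have incr: "c1 \<le> (T y powr r) ^ q - (y powr r) ^ q \<and> (T y powr r) ^ q - (y powr r) ^ q \<le> D * exp D"
    if "y > M" for y
  proof -
    have y: "0 < y" "M0 \<le> y" "M1 \<le> y" "1 \<le> y" using that by (auto simp: M_def)
    define R where "R = (y powr r) ^ q"
    define x where "x = ln (T y) - ln y"
    define z where "z = q * r * x"
    have R: "R \<ge> 1" unfolding R_def using y r by (intro one_le_power ge_one_powr_ge_zero) auto
    note st = step(2,3)[OF y(1,2) sgn[OF that], folded x_def]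
    have "- \<kappa> / 2 / K2 \<le> ((J2 y - J1 y) * R) / K2"
      using M1[OF y(3)] K by (intro divide_right_mono) (auto simp: R_def algebra_simps)
    also have "\<dots> \<le> x * R" using mult_right_mono[OF st(1), of R] R by simp
    finally have "q * r * (- \<kappa> / 2 / K2) \<le> q * r * (x * R)"
      using r by (intro mult_left_mono) auto
    hence zlow: "c1 \<le> R * z" by (simp add: c1_def z_def mult_ac)
    have "x * R \<le> ((J2 y - J1 y) * R) / K1" using mult_right_mono[OF st(2), of R] R by simp
    also have "\<dots> \<le> - 2 * \<kappa> / K1"
      using M1[OF y(3)] K by (intro divide_right_mono) (auto simp: R_def algebra_simps)
    finally have "q * r * (x * R) \<le> q * r * (- 2 * \<kappa> / K1)"
      using r by (intro mult_left_mono) auto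
    hence zup: "R * z \<le> D" by (simp add: D_def z_def mult_ac)
    have zpos: "z \<ge> 0" using zlow c1 R by (smt (verit) mult_nonneg_nonpos)
    have zD: "z \<le> D" using zup R zpos mult_right_mono[of 1 R z] by simp
    have "(T y powr r) ^ q = (y powr r * exp (r * x)) ^ q"
      unfolding x_def using powr_root_ln_diff[of y "T y" r] y up[OF that] by simp
    also have "\<dots> = R * exp z" by (simp add: power_mult_distrib R_def z_def exp_of_nat_mult[symmetric] mult_ac)
    finally have eq: "(T y powr r) ^ q - (y powr r) ^ q = R * (exp z - 1)" by (simp add: R_def algebra_simps)
    have "R * z \<le> R * (exp z - 1)" using R exp_ge_add_one_self[of z] by (intro mult_left_mono) linarith+
    moreover have "R * (exp z - 1) \<le> D * exp D"
    proof -
      have "exp z - 1 = exp z * (1 - exp (-z))" by (simp add: algebra_simps exp_minus)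
      also have "\<dots> \<le> exp z * z" using exp_ge_add_one_self[of "-z"] by (intro mult_left_mono) (linarith, simp)
      finally have "R * (exp z - 1) \<le> R * (exp z * z)" using R by (intro mult_left_mono) auto
      also have "\<dots> = (R * z) * exp z" by simp
      also have "\<dots> \<le> D * exp D" using zup zD zpos by (intro mult_mono) auto
      finally show ?thesis .
    qed
    ultimately show ?thesis unfolding eq using zlow by linarith
  qed
  have "escapes_nondegenerately n (orbit_seq T y0) (real q / (real q + 1))" if y0: "y0 > M" for y0
  proof -
    define y where "y = orbit_seq T y0"
    define \<rho> where "\<rho> l = y l powr r" for l
    have y: "y l > M" for l unfolding y_def using orbit_large up y0 by blast
    have ypos: "y l > 0" for l using y[of l] by (simp add: M_def)
    have rpos: "\<rho> l > 0" for l using ypos[of l] by (simp add: \<rho>_def)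
    have g: "c1 \<le> \<rho> (Suc l) ^ q - \<rho> l ^ q" "\<rho> (Suc l) ^ q - \<rho> l ^ q \<le> D * exp D" for l
      using incr[OF y, of l] by (simp_all add: \<rho>_def y_def orbit_seq_def)
    have "filterlim \<rho> at_top sequentially" by (rule power_growth_at_top[where \<rho> = \<rho>, OF q c1 rpos g(1)])
    hence "filterlim (\<lambda>l. y l powr (1 / (real n + 1))) at_top sequentially"
      unfolding \<rho>_def[abs_def] r_def .
    hence "filterlim y at_top sequentially" by (rule filterlim_from_powr_at_top[OF ypos])
    moreover have "compactified_orbit n y = range (\<lambda>l. 1 / \<rho> l)"
      using ypos by (simp add: compactified_orbit_inverse \<rho>_def r_def)
    ultimately show ?thesis using mink_power_growth[where \<rho> = \<rho>, OF q c1 rpos g]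
      by (simp add: escapes_nondegenerately_def orbit_has_dim_def orbit_nondegenerate_def y_def)
  qed
  thus ?thesis unfolding for_all_suff_large_def by (intro exI[of _ M]) (auto simp: M_def)
qed

end

section \<open>Asymptotics at infinity\<close>

text \<open>\<open>N\<close> only bounds the degree, so a vanishing coefficient at \<open>N\<close>
  is allowed and gives the limit 0. The values 1 and -1 of \<open>s\<close> reach both ends of the
  line through limits at \<open>at_top\<close>.\<close>

lemma poly_over_power_tendsto:
  fixes p :: "real poly"
  assumes "\<And>i. i > N \<Longrightarrow> coeff p i = 0"
  shows "((\<lambda>x. poly p (s * x) / x ^ N) \<longlongrightarrow> s ^ N * coeff p N) at_top"
proof -
  have "degree p \<le> N" using assms degree_le by blast
  hence eq: "poly p (s * x) / x ^ N = (\<Sum>i\<le>N. coeff p i * s ^ i * (x ^ i / x ^ N))" for x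
  proof -
    have "poly p (s * x) = (\<Sum>i\<le>N. coeff p i * (s * x) ^ i)"
      unfolding poly_altdef using \<open>degree p \<le> N\<close>
      by (intro sum.mono_neutral_left) (auto simp: coeff_eq_0)
    thus ?thesis by (simp add: power_mult_distrib sum_divide_distrib mult.assoc)
  qed
  have "((\<lambda>x. coeff p i * s ^ i * (x ^ i / x ^ N)) \<longlongrightarrow> (if i = N then s ^ N * coeff p N else 0)) at_top"
    if "i \<le> N" for i
  proof (cases "i = N")
    case True
    have "eventually (\<lambda>x::real. coeff p i * s ^ i * (x ^ i / x ^ N) = s ^ N * coeff p N) at_top"
      using eventually_gt_at_top[of 0] by eventually_elim (simp add: True)
    thus ?thesis using True by (simp add: tendsto_eventually)
  next
    case False
    hence "((\<lambda>x::real. inverse (x ^ (N - i))) \<longlongrightarrow> 0) at_top" using that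
      by (intro tendsto_inverse_0_at_top filterlim_pow_at_top filterlim_ident) auto
    hence "((\<lambda>x. coeff p i * s ^ i * inverse (x ^ (N - i))) \<longlongrightarrow> coeff p i * s ^ i * 0) at_top"
      by (intro tendsto_intros)
    moreover have "eventually (\<lambda>x::real. coeff p i * s ^ i * (x ^ i / x ^ N) = coeff p i * s ^ i * inverse (x ^ (N - i))) at_top"
      using eventually_gt_at_top[of 0] by eventually_elim (use that in \<open>simp add: power_diff field_simps\<close>)
    ultimately show ?thesis using False by (simp add: tendsto_cong)
  qed
  hence "((\<lambda>x. \<Sum>i\<le>N. coeff p i * s ^ i * (x ^ i / x ^ N)) \<longlongrightarrow> (\<Sum>i\<le>N. if i = N then s ^ N * coeff p N else 0)) at_top"
    by (intro tendsto_sum) auto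
  thus ?thesis unfolding eq by simp
qed

text \<open>The derivative of \<open>k / (q * x ^ q)\<close> is \<open>- k / x ^ Suc q\<close>, so
  for \<open>k\<close> slightly above or below \<open>c\<close> the corrected function has a
  derivative of known sign. This takes the place of integrating the tail of
  \<open>\<psi>'\<close>.\<close>

lemma monotone_powers_tail:
  fixes \<psi> \<psi>' :: "real \<Rightarrow> real"
  assumes deriv: "\<And>x. x > 0 \<Longrightarrow> (\<psi> has_real_derivative \<psi>' x) (at x)"
    and lim: "((\<lambda>x. x ^ Suc q * \<psi>' x) \<longlongrightarrow> c) at_top" and q: "q \<ge> 1" and e: "e > 0"
  obtains x0 where "x0 > 0"
    "\<And>(x::real) (y::real). x0 \<le> x \<Longrightarrow> x \<le> y \<Longrightarrow> \<psi> y + (c + e) / (q * y ^ q) \<le> \<psi> x + (c + e) / (q * x ^ q)"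
    "\<And>(x::real) (y::real). x0 \<le> x \<Longrightarrow> x \<le> y \<Longrightarrow> \<psi> x + (c - e) / (q * x ^ q) \<le> \<psi> y + (c - e) / (q * y ^ q)"
proof -
  have "eventually (\<lambda>x. x ^ Suc q * \<psi>' x > c - e \<and> x ^ Suc q * \<psi>' x < c + e) at_top"
    using order_tendstoD[OF lim] e by (simp add: eventually_conj_iff del: power_Suc)
  then obtain x1 where x1: "\<And>x. x1 \<le> x \<Longrightarrow> x ^ Suc q * \<psi>' x > c - e \<and> x ^ Suc q * \<psi>' x < c + e"
    by (auto simp: eventually_at_top_linorder simp del: power_Suc)
  define x0 where "x0 = max 1 x1"
  have D: "((\<lambda>x. \<psi> x + k / (q * x ^ q)) has_real_derivative (x ^ Suc q * \<psi>' x - k) / x ^ Suc q) (at x)"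
    if "x0 \<le> x" for x k
  proof -
    obtain j where j: "q = Suc j" using q by (cases q) auto
    have "x > 0" using that by (simp add: x0_def)
    thus ?thesis unfolding j
      by (auto intro!: derivative_eq_intros deriv simp del: power_Suc of_nat_Suc)
         (simp add: field_simps)
  qed
  show ?thesis
  proof (rule that[of x0])
    fix x y assume xy: "x0 \<le> x" "x \<le> y"
    show "\<psi> y + (c + e) / (q * y ^ q) \<le> \<psi> x + (c + e) / (q * x ^ q)"
    proof (rule DERIV_nonpos_imp_nonincreasing[OF xy(2)])
      fix z assume z: "x \<le> z" "z \<le> y"
      hence z0: "x0 \<le> z" "z > 0" "x1 \<le> z" using xy by (auto simp: x0_def)
      show "\<exists>d. ((\<lambda>x. \<psi> x + (c + e) / (q * x ^ q)) has_real_derivative d) (at z) \<and> d \<le> 0"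
        using x1[OF z0(3)] z0(2)
        by (intro exI[of _ "(z ^ Suc q * \<psi>' z - (c + e)) / z ^ Suc q"] conjI D z0(1) divide_nonpos_pos)
           (auto simp del: power_Suc)
    qed
    show "\<psi> x + (c - e) / (q * x ^ q) \<le> \<psi> y + (c - e) / (q * y ^ q)"
    proof (rule DERIV_nonneg_imp_nondecreasing[OF xy(2)])
      fix z assume z: "x \<le> z" "z \<le> y"
      hence z0: "x0 \<le> z" "z > 0" "x1 \<le> z" using xy by (auto simp: x0_def)
      show "\<exists>d. ((\<lambda>x. \<psi> x + (c - e) / (q * x ^ q)) has_real_derivative d) (at z) \<and> 0 \<le> d"
        using x1[OF z0(3)] z0(2)
        by (intro exI[of _ "(z ^ Suc q * \<psi>' z - (c - e)) / z ^ Suc q"] conjI D z0(1) divide_nonneg_pos)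
           (auto simp del: power_Suc)
    qed
  qed (simp add: x0_def)
qed

lemma inverse_power_tendsto_0: "q \<ge> 1 \<Longrightarrow> ((\<lambda>x::real. k / (real q * x ^ q)) \<longlongrightarrow> 0) at_top"
  by (intro real_tendsto_divide_at_top[OF tendsto_const] filterlim_tendsto_pos_mult_at_top[OF tendsto_const]
       filterlim_pow_at_top filterlim_ident) auto

text \<open>The increasing corrected function stays below the decreasing one and hence converges,
  and \<psi> with it, as the corrections vanish at infinity. Existence of \<open>L\<close> uses
  \<open>e = 1\<close>; arbitrarily small \<open>e\<close> then gives the exact rate.\<close>

lemma tail_asymptotics:
  fixes \<psi> \<psi>' :: "real \<Rightarrow> real"
  assumes deriv: "\<And>x. x > 0 \<Longrightarrow> (\<psi> has_real_derivative \<psi>' x) (at x)"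
    and lim: "((\<lambda>x. x ^ Suc q * \<psi>' x) \<longlongrightarrow> c) at_top" and q: "q \<ge> 1"
  obtains L where "(\<psi> \<longlongrightarrow> L) at_top" "((\<lambda>x. (\<psi> x - L) * x ^ q) \<longlongrightarrow> - c / q) at_top"
proof -
  obtain x0 where x0: "x0 > 0"
    and dec: "\<And>(x::real) (y::real). x0 \<le> x \<Longrightarrow> x \<le> y \<Longrightarrow> \<psi> y + (c + 1) / (q * y ^ q) \<le> \<psi> x + (c + 1) / (q * x ^ q)"
    and inc: "\<And>(x::real) (y::real). x0 \<le> x \<Longrightarrow> x \<le> y \<Longrightarrow> \<psi> x + (c - 1) / (q * x ^ q) \<le> \<psi> y + (c - 1) / (q * y ^ q)"
    using monotone_powers_tail[where \<psi> = \<psi> and \<psi>' = \<psi>' and c = c and e = 1, OF deriv lim q] by (metis zero_less_one)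
  define v where "v x = \<psi> x + (c - 1) / (q * x ^ q)" for x :: real
  have uv: "v x \<le> \<psi> x + (c + 1) / (q * x ^ q)" if "x0 \<le> x" for x :: real
    unfolding v_def using that x0 by (intro add_left_mono divide_right_mono) auto
  have bdd: "bdd_above (v ` {x0..})"
  proof (rule bdd_aboveI2)
    fix x assume "x \<in> {x0..}"
    thus "v x \<le> \<psi> x0 + (c + 1) / (q * x0 ^ q)" using uv[of x] dec[of x0 x] by simp
  qed
  define L where "L = (SUP x\<in>{x0..}. v x)"
  have "(v \<longlongrightarrow> L) at_top"
  proof (rule increasing_tendsto)
    show "eventually (\<lambda>x. v x \<le> L) at_top"
      using eventually_ge_at_top[of x0] by eventually_elim (auto simp: L_def intro!: cSUP_upper bdd)
  next
    fix z assume "z < L"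
    then obtain x1 where x1: "x0 \<le> x1" "z < v x1"
      using less_cSUP_iff[OF _ bdd, of z] by (auto simp: L_def)
    show "eventually (\<lambda>x. z < v x) at_top"
      using eventually_ge_at_top[of x1]
    proof eventually_elim
      case (elim x)
      thus ?case using inc[of x1 x] x1 by (simp add: v_def)
    qed
  qed
  hence "((\<lambda>x::real. v x - (c - 1) / (q * x ^ q)) \<longlongrightarrow> L - 0) at_top"
    by (intro tendsto_diff inverse_power_tendsto_0 q)
  hence L: "(\<psi> \<longlongrightarrow> L) at_top" by (simp add: v_def)
  have shifted: "((\<lambda>x::real. \<psi> x + k / (q * x ^ q)) \<longlongrightarrow> L) at_top" for k
    using tendsto_add[OF L inverse_power_tendsto_0[OF q, of k]] by simp
  have bounds: "eventually (\<lambda>x. - (c + e) / q \<le> (\<psi> x - L) * x ^ q \<and> (\<psi> x - L) * x ^ q \<le> - (c - e) / q) at_top"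
    if e: "e > 0" for e
  proof -
    obtain x2 where x2: "x2 > 0"
      and dec: "\<And>(x::real) (y::real). x2 \<le> x \<Longrightarrow> x \<le> y \<Longrightarrow> \<psi> y + (c + e) / (q * y ^ q) \<le> \<psi> x + (c + e) / (q * x ^ q)"
      and inc: "\<And>(x::real) (y::real). x2 \<le> x \<Longrightarrow> x \<le> y \<Longrightarrow> \<psi> x + (c - e) / (q * x ^ q) \<le> \<psi> y + (c - e) / (q * y ^ q)"
      using monotone_powers_tail[where \<psi> = \<psi> and \<psi>' = \<psi>' and c = c and e = e, OF deriv lim q e] by metis
    show ?thesis using eventually_ge_at_top[of x2]
    proof eventually_elim
      case (elim x)
      have x: "x > 0" using elim x2 by simp
      \<comment> \<open>Monotonicity is applied between \<open>x\<close> and a second argument sent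
        to infinity, where the corrected function tends to \<open>L\<close>.\<close>
      have "L \<le> \<psi> x + (c + e) / (q * x ^ q)"
        by (rule tendsto_upperbound[OF shifted[of "c + e"] eventually_mono[OF eventually_ge_at_top[of x]]])
           (use dec elim in auto)
      hence "- ((c + e) / q / x ^ q) \<le> \<psi> x - L" by simp
      hence 1: "- ((c + e) / q / x ^ q) * x ^ q \<le> (\<psi> x - L) * x ^ q" using x by (intro mult_right_mono) auto
      have "\<psi> x + (c - e) / (q * x ^ q) \<le> L"
        by (rule tendsto_lowerbound[OF shifted[of "c - e"] eventually_mono[OF eventually_ge_at_top[of x]]])
           (use inc elim in auto)
      hence "\<psi> x - L \<le> - ((c - e) / q / x ^ q)" by simp
      hence 2: "(\<psi> x - L) * x ^ q \<le> - ((c - e) / q / x ^ q) * x ^ q" using x by (intro mult_right_mono) auto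
      have cancel: "- (k / q / x ^ q) * x ^ q = - k / q" for k using x by simp
      show ?case using 1 2 unfolding cancel by simp
    qed
  qed
  have "((\<lambda>x. (\<psi> x - L) * x ^ q) \<longlongrightarrow> - c / q) at_top"
  proof (rule order_tendstoI)
    fix a assume a: "a < - c / q"
    \<comment> \<open>Chosen so that \<open>- (c + e) / q\<close> is the midpoint of
      \<open>a\<close> and \<open>- c / q\<close>.\<close>
    define e where "e = (- c / q - a) * q / 2"
    have e: "e > 0" using a q by (simp add: e_def)
    have "e / q = (- c / q - a) / 2" using q by (simp add: e_def)
    hence "a < - (c + e) / q" using a by (simp add: add_divide_distrib diff_divide_distrib)
    thus "eventually (\<lambda>x. a < (\<psi> x - L) * x ^ q) at_top"
      using bounds[OF e] by (auto elim!: eventually_mono)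
  next
    fix a assume a: "a > - c / q"
    define e where "e = (a + c / q) * q / 2"
    have e: "e > 0" using a q by (simp add: e_def)
    have "e / q = (a + c / q) / 2" using q by (simp add: e_def)
    hence "a > - (c - e) / q" using a by (simp add: add_divide_distrib diff_divide_distrib)
    thus "eventually (\<lambda>x. a > (\<psi> x - L) * x ^ q) at_top"
      using bounds[OF e] by (auto elim!: eventually_mono)
  qed
  with L show ?thesis by (rule that)
qed

section \<open>One branch of the critical curve\<close>

text \<open>
  The right branch is \<open>P x = F x\<close>; the left one is reflected to \<open>P x = F (- x)\<close>, with \<open>\<Phi>\<close> reflected
  accordingly.
\<close>

locale branch =
  fixes P P' \<Phi> \<phi> :: "real \<Rightarrow> real" and K :: real
  assumes P0: "P 0 = 0" and \<Phi>0: "\<Phi> 0 = 0"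
    and DP: "\<And>x. (P has_real_derivative P' x) (at x)"
    and P'_pos: "\<And>x. x > 0 \<Longrightarrow> P' x > 0"
    and P_top: "filterlim P at_top at_top"
    and D\<Phi>: "\<And>x. (\<Phi> has_real_derivative \<phi> x) (at x)"
    and \<phi>_neg: "\<And>x. x > 0 \<Longrightarrow> \<phi> x < 0"
    and K_pos: "K > 0"
    and lim: "((\<lambda>x. \<phi> x * P x / P' x) \<longlongrightarrow> - K) at_top"
begin

text \<open>Zero is treated apart exactly as in \<open>omega\<close>, so that on the right branch
  both unfold to the same term; on the reflected left branch \<open>W\<close> is
  \<open>- alpha\<close> at nonnegative arguments.\<close>

definition W :: "real \<Rightarrow> real" where
  "W y = (if y = 0 then 0 else (THE x. 0 < x \<and> P x = y))"

lemma cont_P: "continuous_on A P"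
  using DP DERIV_isCont continuous_at_imp_continuous_on by blast

lemma cont_\<Phi>: "continuous_on A \<Phi>"
  using D\<Phi> DERIV_isCont continuous_at_imp_continuous_on by blast

lemma P_strict: "0 \<le> x \<Longrightarrow> x < y \<Longrightarrow> P x < P y"
  by (rule DERIV_pos_imp_increasing_open[OF _ _ cont_P]) (auto intro!: exI conjI DP P'_pos)

lemma \<Phi>_strict: "0 \<le> x \<Longrightarrow> x < y \<Longrightarrow> \<Phi> y < \<Phi> x"
  by (rule DERIV_neg_imp_decreasing_open[OF _ _ cont_\<Phi>]) (auto intro!: exI conjI D\<Phi> \<phi>_neg)

lemma P_less_iff: "0 \<le> x \<Longrightarrow> 0 \<le> y \<Longrightarrow> P x < P y \<longleftrightarrow> x < y"
  by (metis P_strict linorder_neqE_linordered_idom order_less_asym)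

lemma P_eq_iff: "0 \<le> x \<Longrightarrow> 0 \<le> y \<Longrightarrow> P x = P y \<longleftrightarrow> x = y"
  by (metis P_less_iff linorder_neq_iff)

lemma P_nonneg: "0 \<le> x \<Longrightarrow> 0 \<le> P x"
  using P_strict[of 0 x] P0 by (cases "x = 0") auto

lemma P_surj:
  assumes "0 \<le> y"
  obtains x where "0 \<le> x" "P x = y"
proof -
  have "eventually (\<lambda>x. y \<le> P x \<and> 0 \<le> x) at_top"
    using P_top by (intro eventually_conj eventually_ge_at_top) (auto simp: filterlim_at_top)
  then obtain b where "y \<le> P b" "0 \<le> b" by (auto simp: eventually_at_top_linorder)
  thus ?thesis using IVT'[of P 0 y b] assms P0 cont_P that by metis
qed

lemma W_P: "0 \<le> x \<Longrightarrow> W (P x) = x"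
  using P_eq_iff[of x 0] P0 P_eq_iff by (auto simp: W_def intro!: the_equality)

lemma W_props:
  assumes "0 \<le> y"
  shows "0 \<le> W y" "P (W y) = y"
  using P_surj[OF assms] W_P by metis+

lemma W_strict: "0 \<le> y \<Longrightarrow> y < z \<Longrightarrow> W y < W z"
  using P_less_iff[of "W y" "W z"] W_props[of y] W_props[of z] by simp

lemma W_top: "filterlim W at_top at_top"
  unfolding filterlim_at_top
proof
  fix Z
  show "eventually (\<lambda>y. Z \<le> W y) at_top"
    using eventually_gt_at_top[of "P \<bar>Z\<bar>"]
  proof eventually_elim
    case (elim y)
    have "0 \<le> y" using P_nonneg[of "\<bar>Z\<bar>"] elim by simp
    have "P \<bar>Z\<bar> < P (W y)" using W_props[of y] elim \<open>0 \<le> y\<close> by simp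
    hence "\<bar>Z\<bar> < W y" using P_less_iff[of "\<bar>Z\<bar>" "W y"] W_props[of y] \<open>0 \<le> y\<close> by simp
    thus ?case by simp
  qed
qed

definition J :: "real \<Rightarrow> real" where "J y = \<Phi> (W y)"

lemma J_0: "J 0 = 0"
  by (simp add: J_def W_def \<Phi>0)

lemma J_strict: "0 \<le> y \<Longrightarrow> y < z \<Longrightarrow> J z < J y"
  unfolding J_def by (intro \<Phi>_strict W_strict W_props)

lemma J_mono: "0 \<le> y \<Longrightarrow> y \<le> z \<Longrightarrow> J z \<le> J y"
  using J_strict[of y z] by (cases "y = z") auto

lemma J_inj: "J y = J z \<Longrightarrow> 0 \<le> y \<Longrightarrow> 0 \<le> z \<Longrightarrow> y = z"
  using J_strict[of y z] J_strict[of z y] by (cases y z rule: linorder_cases) auto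

text \<open>The hypothesis \<open>lim\<close> says that \<Phi>, regarded as a function of
  \<open>ln P\<close>, has slope tending to \<open>- K\<close>. Cauchy's mean value theorem for
  \<Phi> against \<open>ln P\<close> transfers this to differences; the factors 1/2 and 2 are
  slack.\<close>

lemma J_log_bounds:
  obtains M where "M > 0"
    "\<And>y z. M \<le> y \<Longrightarrow> y \<le> z \<Longrightarrow> K / 2 * (ln z - ln y) \<le> J y - J z \<and> J y - J z \<le> 2 * K * (ln z - ln y)"
proof -
  have "eventually (\<lambda>x. \<phi> x * P x / P' x < - K / 2 \<and> \<phi> x * P x / P' x > - 2 * K) at_top"
    using order_tendstoD(1)[OF lim, of "- 2 * K"] order_tendstoD(2)[OF lim, of "- K / 2"] K_pos
    by (intro eventually_conj) auto
  then obtain x0 where x0: "\<And>x. x \<ge> x0 \<Longrightarrow> \<phi> x * P x / P' x < - K / 2 \<and> \<phi> x * P x / P' x > - 2 * K"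
    by (auto simp: eventually_at_top_linorder)
  define x1 where "x1 = max 1 x0"
  define M where "M = P x1"
  have M: "M > 0" using P_strict[of 0 x1] P0 by (simp add: M_def x1_def)
  have "K / 2 * (ln z - ln y) \<le> J y - J z \<and> J y - J z \<le> 2 * K * (ln z - ln y)"
    if yz: "M \<le> y" "y < z" for y z
  proof -
    define a where "a = W y"
    define b where "b = W z"
    have ab: "P a = y" "P b = z" "a < b" "0 \<le> a"
      using W_props[of y] W_props[of z] W_strict[of y z] yz M by (auto simp: a_def b_def)
    have "x1 \<le> a" using ab yz(1) P_less_iff[of a x1] by (force simp: M_def x1_def not_less)
    hence a: "a > 0" "x0 \<le> a" by (auto simp: x1_def)
    have Ppos: "P x > 0" if "x \<ge> a" for x using P_strict[of 0 x] P0 that a by simp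
    have Dln: "((\<lambda>x. ln (P x)) has_real_derivative P' x / P x) (at x)" if "x \<ge> a" for x
      using Ppos[OF that] DP by (auto intro!: derivative_eq_intros)
    have "\<exists>c. a < c \<and> c < b \<and> (\<Phi> b - \<Phi> a) * (P' c / P c) = (ln (P b) - ln (P a)) * \<phi> c"
    proof (rule GMVT')
      show "((\<lambda>x. ln (P x)) has_real_derivative P' x / P x) (at x)" if "a < x" "x < b" for x
        using that by (intro Dln) auto
      show "isCont (\<lambda>x. ln (P x)) x" if "a \<le> x" "x \<le> b" for x
        using that by (intro DERIV_isCont[OF Dln])
    qed (use ab D\<Phi> DERIV_isCont in auto)
    then obtain c where c: "a < c" "c < b" "(\<Phi> b - \<Phi> a) * (P' c / P c) = (ln z - ln y) * \<phi> c"
      using ab by auto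
    have P'c: "P' c > 0" "P c > 0" using P'_pos[of c] Ppos[of c] c a by auto
    define k where "k = - (\<phi> c * P c / P' c)"
    have k: "K / 2 \<le> k" "k \<le> 2 * K" using x0[of c] c a by (auto simp: k_def)
    have "J y - J z = (ln z - ln y) * k"
      using c(3) P'c by (simp add: J_def a_def b_def k_def field_simps)
    moreover have "ln z - ln y \<ge> 0" using yz M by simp
    ultimately show ?thesis
      using mult_right_mono[OF k(1), of "ln z - ln y"] mult_right_mono[OF k(2), of "ln z - ln y"]
      by (simp add: mult.commute)
  qed
  hence "K / 2 * (ln z - ln y) \<le> J y - J z \<and> J y - J z \<le> 2 * K * (ln z - ln y)"
    if "M \<le> y" "y \<le> z" for y z using that by (cases "y = z") auto
  with M show ?thesis by (rule that)
qed

text \<open>The logarithmic lower bound makes \<open>J\<close> unbounded below. The intermediate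
  value theorem is applied to \<Phi> instead of \<open>J\<close>, which avoids discussing the
  continuity of \<open>W\<close>.\<close>

lemma J_surj:
  assumes "v \<le> 0"
  obtains y where "0 \<le> y" "J y = v"
proof -
  obtain M where M: "M > 0"
    "\<And>y z. M \<le> y \<Longrightarrow> y \<le> z \<Longrightarrow> K / 2 * (ln z - ln y) \<le> J y - J z \<and> J y - J z \<le> 2 * K * (ln z - ln y)"
    using J_log_bounds by blast
  \<comment> \<open>Solves \<open>K / 2 * (ln z - ln M) = \<bar>J M - v\<bar>\<close>, which pushes
    \<open>J z\<close> down to \<open>v\<close> or below.\<close>
  define z where "z = M * exp (2 * \<bar>J M - v\<bar> / K)"
  have "M * 1 \<le> z" unfolding z_def using M K_pos by (intro mult_left_mono) auto
  hence z: "M \<le> z" by simp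
  have "K / 2 * (ln z - ln M) = \<bar>J M - v\<bar>" using M(1) K_pos by (simp add: z_def ln_mult)
  hence "J z \<le> v" using M(2)[OF order_refl z] by linarith
  hence "\<exists>x\<ge>0. x \<le> W z \<and> \<Phi> x = v"
    using assms W_props[of z] z M(1) \<Phi>0 by (intro IVT2' cont_\<Phi>) (auto simp: J_def)
  then obtain x where "x \<ge> 0" "\<Phi> x = v" by auto
  thus ?thesis using that[of "P x"] P_nonneg W_P by (simp add: J_def)
qed

text \<open>This is the \<open>N\<close>-th root of \<open>P (W y) / W y ^ N\<close>. It lets
  \<open>y powr (1 / N)\<close> replace the coordinate of either branch in later limits.\<close>

lemma powr_div_W_tendsto:
  assumes N: "N \<ge> 1" and limP: "((\<lambda>x. P x / x ^ N) \<longlongrightarrow> 1) at_top"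
  shows "((\<lambda>y. y powr (1 / real N) / W y) \<longlongrightarrow> 1) at_top"
proof -
  have "((\<lambda>y. (P (W y) / W y ^ N) powr (1 / real N)) \<longlongrightarrow> 1 powr (1 / real N)) at_top"
    by (intro tendsto_powr filterlim_compose[OF limP W_top] tendsto_const) auto
  moreover have "eventually (\<lambda>y. (P (W y) / W y ^ N) powr (1 / real N) = y powr (1 / real N) / W y) at_top"
    using eventually_gt_at_top[of 0]
  proof eventually_elim
    case (elim y)
    have W: "0 < W y" "P (W y) = y" using W_props[of y] W_strict[of 0 y] elim by (auto simp: W_def)
    have "(W y ^ N) powr (1 / real N) = W y"
      using W N by (simp add: powr_realpow[symmetric] powr_powr)
    thus ?case using W elim by (simp add: powr_divide)
  qed
  ultimately show ?thesis by (simp add: tendsto_cong)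
qed

end

section \<open>Slow divergence integrals\<close>

lemma tendsto_at_top_divide:
  fixes u v :: "real \<Rightarrow> real"
  assumes "(u \<longlongrightarrow> a) at_top" "(v \<longlongrightarrow> b) at_top" "b \<noteq> 0"
    "\<And>x. x > 0 \<Longrightarrow> w x = u x / v x" "c = a / b"
  shows "(w \<longlongrightarrow> c) at_top"
proof -
  have "((\<lambda>x. u x / v x) \<longlongrightarrow> c) at_top" unfolding assms(5) by (intro tendsto_divide assms)
  moreover have "eventually (\<lambda>x. w x = u x / v x) at_top"
    using eventually_gt_at_top[of 0] by eventually_elim (rule assms)
  ultimately show ?thesis by (simp add: tendsto_cong)
qed

lemma DERIV_compose_uminus:
  fixes g :: "real \<Rightarrow> real"
  assumes "(g has_real_derivative d) (at (- x))"
  shows "((\<lambda>x. g (- x)) has_real_derivative - d) (at x)"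
  using DERIV_chain2[where g = uminus, OF assms DERIV_minus[OF DERIV_ident]] by simp

lemma filterlim_at_top_of_ratio:
  fixes u :: "real \<Rightarrow> real"
  assumes "((\<lambda>x. u x / x ^ Suc n) \<longlongrightarrow> 1) at_top"
  shows "filterlim u at_top at_top"
proof -
  have "filterlim (\<lambda>x. u x / x ^ Suc n * x ^ Suc n) at_top at_top"
    by (intro filterlim_tendsto_pos_mult_at_top[OF assms] filterlim_pow_at_top filterlim_ident) auto
  moreover have "eventually (\<lambda>x. u x / x ^ Suc n * x ^ Suc n = u x) at_top"
    using eventually_gt_at_top[of 0] by eventually_elim simp
  ultimately show ?thesis by (simp add: filterlim_cong)
qed

text \<open>\<open>P\<close> and \<open>Q\<close> are the polynomial quotients of \<open>F'\<close>
  and \<open>G\<close> by \<open>x\<close>. Their signs on the whole line include the conditions at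
  0 and remove the singularity of the integrand there.\<close>

locale lienard =
  fixes n :: nat and A :: real and F G P Q :: "real poly"
  assumes n: "odd n" and A: "A > 0"
    and F_lead: "coeff F (Suc n) = 1" and F_deg: "\<And>i. i > Suc n \<Longrightarrow> coeff F i = 0"
    and G_lead: "coeff G (2 * n + 1) = - A" and G_deg: "\<And>i. i > 2 * n + 1 \<Longrightarrow> coeff G i = 0"
    and F0: "poly F 0 = 0"
    and F'_eq: "\<And>x. poly (pderiv F) x = x * poly P x" and P_pos: "\<And>x. poly P x > 0"
    and G_eq: "\<And>x. poly G x = x * poly Q x" and Q_neg: "\<And>x. poly Q x < 0"
begin

definition f :: "real \<Rightarrow> real" where
  "f x = (poly (pderiv F) x)\<^sup>2 / poly G x"

lemma f_eq: "f x = x * (poly P x)\<^sup>2 / poly Q x"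
  using Q_neg[of x] by (simp add: f_def F'_eq G_eq power2_eq_square)

lemma f_sign: "x > 0 \<Longrightarrow> f x < 0" "x < 0 \<Longrightarrow> f x > 0"
proof -
  have "(poly P x)\<^sup>2 / poly Q x < 0" using P_pos[of x] Q_neg[of x] by (intro divide_pos_neg) auto
  moreover have "f x = x * ((poly P x)\<^sup>2 / poly Q x)" by (simp add: f_eq)
  ultimately show "x > 0 \<Longrightarrow> f x < 0" "x < 0 \<Longrightarrow> f x > 0"
    by (simp_all only: mult_pos_neg mult_neg_neg)
qed

lemma continuous_on_f: "continuous_on S f"
proof -
  have "continuous_on S (\<lambda>x. x * (poly P x)\<^sup>2 / poly Q x)"
    using Q_neg by (intro continuous_intros) (metis less_irrefl)
  thus ?thesis by (simp add: f_eq[abs_def])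
qed

definition \<Phi> :: "real \<Rightarrow> real" where
  "\<Phi> = (SOME g. g 0 = 0 \<and> (\<forall>x. (g has_real_derivative f x) (at x)))"

lemma \<Phi>_props: "\<Phi> 0 = 0" "(\<Phi> has_real_derivative f x) (at x)"
proof -
  have "\<exists>g. \<forall>x::real. -\<infinity> < ereal x \<longrightarrow> ereal x < \<infinity> \<longrightarrow> (g has_vector_derivative f x) (at x)"
    using continuous_on_f[of UNIV]
    by (intro einterval_antiderivative) (auto simp: continuous_on_eq_continuous_at[OF open_UNIV])
  then obtain g where g: "\<And>x. (g has_real_derivative f x) (at x)"
    by (auto simp: has_real_derivative_iff_has_vector_derivative)
  have "\<exists>g. g 0 = 0 \<and> (\<forall>x. (g has_real_derivative f x) (at x))"
    by (rule exI[of _ "\<lambda>x. g x - g 0"]) (auto intro!: derivative_eq_intros g)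
  from someI_ex[OF this] show "\<Phi> 0 = 0" "(\<Phi> has_real_derivative f x) (at x)"
    by (auto simp: \<Phi>_def)
qed

lemma F_lim: "((\<lambda>x. poly F x / x ^ Suc n) \<longlongrightarrow> 1) at_top"
  using poly_over_power_tendsto[where N = "Suc n", OF F_deg, where s = 1] by (simp add: F_lead)

lemma F_lim_minus: "((\<lambda>x. poly F (- x) / x ^ Suc n) \<longlongrightarrow> 1) at_top"
  using poly_over_power_tendsto[where N = "Suc n", OF F_deg, where s = "-1"] n by (simp add: F_lead)

lemma F'_coeff: "coeff (pderiv F) n = real n + 1" "i > n \<Longrightarrow> coeff (pderiv F) i = 0"
  using F_lead F_deg by (auto simp: coeff_pderiv)

lemma F'_lim: "((\<lambda>x. poly (pderiv F) x / x ^ n) \<longlongrightarrow> real n + 1) at_top"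
  using poly_over_power_tendsto[where N = "n", OF F'_coeff(2), where s = 1] by (simp add: F'_coeff)

lemma F'_lim_minus: "((\<lambda>x. poly (pderiv F) (- x) / x ^ n) \<longlongrightarrow> - (real n + 1)) at_top"
  using poly_over_power_tendsto[where N = "n", OF F'_coeff(2), where s = "-1"] n by (simp add: F'_coeff)

lemma G_lim: "((\<lambda>x. poly G x / x ^ (2 * n + 1)) \<longlongrightarrow> - A) at_top"
  using poly_over_power_tendsto[where N = "2 * n + 1", OF G_deg, where s = 1] by (simp add: G_lead[simplified])

lemma G_lim_minus: "((\<lambda>x. poly G (- x) / x ^ (2 * n + 1)) \<longlongrightarrow> A) at_top"
  using poly_over_power_tendsto[where N = "2 * n + 1", OF G_deg, where s = "-1"] by (simp add: G_lead[simplified])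

text \<open>Here \<open>f * F / F'\<close> reduces to \<open>F' * F / G\<close>, whose numerator and
  denominator both have degree \<open>2 * n + 1\<close>. This balance, due to
  \<open>m = 2 * n + 1\<close>, is what makes the integrals diverge logarithmically.\<close>

sublocale pos: branch "poly F" "poly (pderiv F)" \<Phi> f "(real n + 1) / A"
proof
  show "(poly F has_real_derivative poly (pderiv F) x) (at x)" for x by (rule poly_DERIV)
  show "((\<lambda>x. f x * poly F x / poly (pderiv F) x) \<longlongrightarrow> - ((real n + 1) / A)) at_top"
  proof (rule tendsto_at_top_divide[OF tendsto_mult[OF F'_lim F_lim] G_lim])
    fix x :: real assume x: "x > 0"
    thus "f x * poly F x / poly (pderiv F) x =
      poly (pderiv F) x / x ^ n * (poly F x / x ^ Suc n) / (poly G x / x ^ (2 * n + 1))"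
      using P_pos[of x] Q_neg[of x]
      by (simp add: f_def F'_eq G_eq field_simps power2_eq_square power_add[symmetric] mult_2 mult_2_right)
  qed (use A in auto)
qed (use \<Phi>_props F0 P_pos A f_sign filterlim_at_top_of_ratio[OF F_lim] in
   \<open>auto simp: F'_eq zero_less_mult_iff \<close>)

text \<open>Under reflection the leading behaviour of both \<open>F'\<close> and \<open>G\<close>
  changes sign, as \<open>n\<close> and \<open>2 * n + 1\<close> are odd, so the same constant
  \<open>(n + 1) / A\<close> arises.\<close>

sublocale neg: branch "\<lambda>x. poly F (- x)" "\<lambda>x. - poly (pderiv F) (- x)" "\<lambda>x. \<Phi> (- x)" "\<lambda>x. - f (- x)" "(real n + 1) / A"
proof
  show "((\<lambda>x. - f (- x) * poly F (- x) / - poly (pderiv F) (- x)) \<longlongrightarrow> - ((real n + 1) / A)) at_top"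
  proof (rule tendsto_at_top_divide[OF tendsto_mult[OF F'_lim_minus F_lim_minus] G_lim_minus])
    fix x :: real assume x: "x > 0"
    thus "- f (- x) * poly F (- x) / - poly (pderiv F) (- x) =
      poly (pderiv F) (- x) / x ^ n * (poly F (- x) / x ^ Suc n) / (poly G (- x) / x ^ (2 * n + 1))"
      using P_pos[of "-x"] Q_neg[of "-x"]
      by (simp add: f_def F'_eq G_eq field_simps power2_eq_square power_add[symmetric] mult_2 mult_2_right)
  qed (use A in \<open>auto simp: field_simps\<close>)
  show "((\<lambda>x. \<Phi> (- x)) has_real_derivative - f (- x)) (at x)" for x
    by (rule DERIV_compose_uminus[OF \<Phi>_props(2)])
  show "((\<lambda>x. poly F (- x)) has_real_derivative - poly (pderiv F) (- x)) (at x)" for x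
    by (rule DERIV_compose_uminus[OF poly_DERIV])
qed (use \<Phi>_props F0 P_pos A f_sign filterlim_at_top_of_ratio[OF F_lim_minus] in
   \<open>auto simp: F'_eq zero_less_mult_iff \<close>)

lemma I_minus_eq: "I_minus F G y = pos.J y"
proof -
  have om: "omega F y = pos.W y" by (simp add: omega_def pos.W_def)
  have "(LBINT x = ereal (pos.W y)..ereal 0. f x) = \<Phi> 0 - \<Phi> (pos.W y)"
    by (rule interval_integral_FTC_finite[OF continuous_on_f])
       (use \<Phi>_props in \<open>auto simp: has_real_derivative_iff_has_vector_derivative
          intro: has_vector_derivative_at_within\<close>)
  thus ?thesis by (simp add: I_minus_def om pos.J_def \<Phi>_props f_def[abs_def] zero_ereal_def)
qed

text \<open>Unlike \<open>omega\<close>, \<open>alpha\<close> is not literally a \<open>W\<close>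
  but a reflected description. Resolving it needs an existing solution, hence
  \<open>0 \<le> y\<close>.\<close>

lemma I_plus_eq:
  assumes "0 \<le> y"
  shows "I_plus F G y = neg.J y"
proof -
  have al: "alpha F y = - neg.W y"
  proof (cases "y = 0")
    case False
    have W: "neg.W y > 0" "poly F (- neg.W y) = y"
      using False assms neg.W_props[of y] neg.W_strict[of 0 y] by (auto simp: neg.W_def)
    have "(THE x. x < 0 \<and> poly F x = y) = - neg.W y"
    proof (rule the_equality)
      fix x assume "x < 0 \<and> poly F x = y"
      thus "x = - neg.W y" using neg.W_P[of "-x"] by auto
    qed (use W in auto)
    thus ?thesis using False by (simp add: alpha_def)
  qed (simp add: alpha_def neg.W_def)
  have "(LBINT x = ereal (- neg.W y)..ereal 0. f x) = \<Phi> 0 - \<Phi> (- neg.W y)"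
    by (rule interval_integral_FTC_finite[OF continuous_on_f])
       (use \<Phi>_props in \<open>auto simp: has_real_derivative_iff_has_vector_derivative
          intro: has_vector_derivative_at_within\<close>)
  thus ?thesis by (simp add: I_plus_def al neg.J_def \<Phi>_props f_def[abs_def] zero_ereal_def)
qed

end

section \<open>Leading asymptotics of the slow divergence integral\<close>

context lienard
begin

text \<open>Twice the odd part of \<open>F\<close>. Together with \<open>E\<close>, twice the even
  part of \<open>G\<close>, it measures the failure of the symmetry under which \<open>I\<close>
  would vanish.\<close>

definition D :: "real poly" where "D = F - pcompose F [:0, -1:]"
definition E :: "real poly" where "E = G + pcompose G [:0, -1:]"

lemma poly_D: "poly D x = poly F x - poly F (- x)"
  by (simp add: D_def poly_pcompose)

lemma poly_D': "poly (pderiv D) x = poly (pderiv F) x + poly (pderiv F) (- x)"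
  by (simp add: D_def poly_pcompose pderiv_diff pderiv_pcompose pderiv_pCons)

lemma poly_E: "poly E x = poly G x + poly G (- x)"
  by (simp add: E_def poly_pcompose)

lemma coeff_D: "coeff D i = (if odd i then 2 * coeff F i else 0)"
  by (simp add: D_def coeff_pcompose_linear)

lemma coeff_E: "coeff E i = (if even i then 2 * coeff G i else 0)"
  by (simp add: E_def coeff_pcompose_linear)

lemma W_ratio:
  "((\<lambda>y. y powr (1 / (real n + 1)) / pos.W y) \<longlongrightarrow> 1) at_top"
  "((\<lambda>y. y powr (1 / (real n + 1)) / neg.W y) \<longlongrightarrow> 1) at_top"
  using pos.powr_div_W_tendsto[OF _ F_lim] neg.powr_div_W_tendsto[OF _ F_lim_minus]
  by (simp_all add: add.commute)

text \<open>Cauchy's mean value theorem for \<Phi> against \<open>F\<close>, with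
  \<open>f / F' = F' / G\<close>. Measuring by \<open>F\<close> pays off because \<open>F\<close>
  takes the same value at \<open>pos.W y\<close> and at \<open>- neg.W y\<close>: the difference of
  \<open>F\<close> at the two arguments is then given by \<open>D\<close>, without expanding the
  branch maps.\<close>

lemma \<Phi>_diff:
  assumes "a > 0" "b > 0"
  shows "\<exists>\<xi>. min a b \<le> \<xi> \<and> \<xi> \<le> max a b \<and>
     \<Phi> a - \<Phi> b = (poly F a - poly F b) * (poly (pderiv F) \<xi> / poly G \<xi>)"
proof -
  have *: "\<exists>\<xi>. a < \<xi> \<and> \<xi> < b \<and> \<Phi> b - \<Phi> a = (poly F b - poly F a) * (poly (pderiv F) \<xi> / poly G \<xi>)"
    if "0 < a" "a < b" for a b
  proof -
    have "\<exists>\<xi>. a < \<xi> \<and> \<xi> < b \<and> (\<Phi> b - \<Phi> a) * poly (pderiv F) \<xi> = (poly F b - poly F a) * f \<xi>"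
      using that by (intro GMVT' DERIV_isCont[OF \<Phi>_props(2)] \<Phi>_props poly_DERIV) auto
    then obtain \<xi> where \<xi>: "a < \<xi>" "\<xi> < b"
      "(\<Phi> b - \<Phi> a) * poly (pderiv F) \<xi> = (poly F b - poly F a) * f \<xi>" by blast
    have "poly (pderiv F) \<xi> > 0" using \<xi> that P_pos[of \<xi>] by (simp add: F'_eq)
    hence "\<Phi> b - \<Phi> a = (poly F b - poly F a) * (f \<xi> / poly (pderiv F) \<xi>)"
      using \<xi>(3) by (simp add: field_simps)
    also have "f \<xi> / poly (pderiv F) \<xi> = poly (pderiv F) \<xi> / poly G \<xi>"
      using \<open>poly (pderiv F) \<xi> > 0\<close> by (simp add: f_def power2_eq_square)
    finally show ?thesis using \<xi>(1,2) by blast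
  qed
  show ?thesis
  proof (cases a b rule: linorder_cases)
    case less
    then obtain \<xi> where \<xi>: "a < \<xi>" "\<xi> < b" "\<Phi> b - \<Phi> a = (poly F b - poly F a) * (poly (pderiv F) \<xi> / poly G \<xi>)"
      using *[of a b] assms by blast
    have "\<Phi> a - \<Phi> b = - ((poly F b - poly F a) * (poly (pderiv F) \<xi> / poly G \<xi>))" using \<xi>(3) by simp
    also have "\<dots> = (poly F a - poly F b) * (poly (pderiv F) \<xi> / poly G \<xi>)" by (simp only: mult_minus_left[symmetric] minus_diff_eq)
    finally show ?thesis using \<xi> less by (intro exI[of _ \<xi>]) auto
  next
    case greater
    then obtain \<xi> where "b < \<xi>" "\<xi> < a" "\<Phi> a - \<Phi> b = (poly F a - poly F b) * (poly (pderiv F) \<xi> / poly G \<xi>)"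
      using *[of b a] assms by blast
    thus ?thesis using greater by (intro exI[of _ \<xi>]) auto
  qed (auto intro!: exI[of _ b])
qed

text \<open>
  \<open>I y = (\<Phi> \<omega> - \<Phi> (- \<alpha>)) + (\<Phi> (- \<alpha>) - \<Phi> \<alpha>)\<close>. By the generalized mean value theorem the first term is
  \<open>- D (- \<alpha>) * F' \<xi> / G \<xi>\<close> with \<open>D x = F x - F (- x)\<close>; the second is a function of \<open>- \<alpha>\<close> whose
  derivative \<open>f x + f (- x)\<close> is rational, and it converges at the rate given by its tail.
  The choice \<open>q = 1\<close> satisfies the hypotheses for all \<open>F\<close> and \<open>G\<close> and so yields the convergence of \<open>I\<close>.
\<close>

lemma slow_div_int_asymptotics:
  assumes q: "q \<ge> 1"
    and F_odd: "\<And>i. odd i \<Longrightarrow> i + q > n + 1 \<Longrightarrow> coeff F i = 0"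
    and G_even: "\<And>i. even i \<Longrightarrow> i + q > 2 * n + 1 \<Longrightarrow> coeff G i = 0"
    and odd_q: "odd q"
  defines "\<beta> \<equiv> (if q \<le> n + 1 then coeff F (n + 1 - q) else 0)"
    and "\<gamma> \<equiv> (if q \<le> 2 * n + 1 then coeff G (2 * n + 1 - q) else 0)"
  obtains L where "(slow_div_int F G \<longlongrightarrow> L) at_top"
    "((\<lambda>y. (slow_div_int F G y - L) * (y powr (1 / (real n + 1))) ^ q) \<longlongrightarrow>
       2 * (real n + 1) / (A * q) * (\<beta> * (2 * real n + 2 - q) + \<gamma> * (real n + 1) / A)) at_top"
proof -
  define c where "c = - (2 * \<gamma> * (real n + 1)\<^sup>2 + 4 * A * \<beta> * (real n + 1 - q) * (real n + 1)) / A\<^sup>2"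
  have lD: "((\<lambda>x. x ^ q * poly D x / x ^ Suc n) \<longlongrightarrow> 2 * \<beta>) at_top"
  proof -
    have "coeff (monom 1 q * D) i = 0" if "i > Suc n" for i
      using that F_odd[of "i - q"] by (auto simp: coeff_monom_mult coeff_D)
    from poly_over_power_tendsto[where N = "Suc n" and s = 1, OF this]
    have "((\<lambda>x. x ^ q * poly D x / x ^ Suc n) \<longlongrightarrow> coeff (monom 1 q * D) (Suc n)) at_top"
      by (simp add: poly_monom)
    \<comment> \<open>The index \<open>n + 1 - q\<close> is odd because \<open>n\<close> and
      \<open>q\<close> are, so \<open>D\<close> retains this coefficient of \<open>F\<close>; for
      \<open>q > n + 1\<close> both sides are 0, the default in \<beta>.\<close>
    also have "coeff (monom 1 q * D) (Suc n) = 2 * \<beta>"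
      using n odd_q by (auto simp: coeff_monom_mult coeff_D \<beta>_def)
    finally show ?thesis .
  qed
  have lD': "((\<lambda>x. x ^ q * poly (pderiv D) x / x ^ n) \<longlongrightarrow> 2 * \<beta> * (real n + 1 - q)) at_top"
  proof -
    have "coeff (monom 1 q * pderiv D) i = 0" if "i > n" for i
      using that F_odd[of "Suc (i - q)"] by (auto simp: coeff_monom_mult coeff_D coeff_pderiv)
    from poly_over_power_tendsto[where N = "n" and s = 1, OF this]
    have "((\<lambda>x. x ^ q * poly (pderiv D) x / x ^ n) \<longlongrightarrow> coeff (monom 1 q * pderiv D) n) at_top"
      by (simp add: poly_monom)
    also have "coeff (monom 1 q * pderiv D) n = 2 * \<beta> * (real n + 1 - q)"
      using n odd_q by (auto simp: coeff_monom_mult coeff_D coeff_pderiv \<beta>_def Suc_diff_le of_nat_diff)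
    finally show ?thesis .
  qed
  have lE: "((\<lambda>x. x ^ q * poly E x / x ^ (2 * n + 1)) \<longlongrightarrow> 2 * \<gamma>) at_top"
  proof -
    have "coeff (monom 1 q * E) i = 0" if "i > 2 * n + 1" for i
      using that G_even[of "i - q"] by (auto simp: coeff_monom_mult coeff_E)
    from poly_over_power_tendsto[where N = "2 * n + 1" and s = 1, OF this]
    have "((\<lambda>x. x ^ q * poly E x / x ^ (2 * n + 1)) \<longlongrightarrow> coeff (monom 1 q * E) (2 * n + 1)) at_top"
      by (simp add: poly_monom)
    also have "coeff (monom 1 q * E) (2 * n + 1) = 2 * \<gamma>"
      using odd_q by (auto simp: coeff_monom_mult coeff_E \<gamma>_def)
    finally show ?thesis .
  qed
  define \<psi> where "\<psi> x = \<Phi> x - \<Phi> (- x)" for x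
  have D\<psi>: "(\<psi> has_real_derivative f x + f (- x)) (at x)" for x
    unfolding \<psi>_def[abs_def]
    using DERIV_diff[OF \<Phi>_props(2)[of x] DERIV_compose_uminus[OF \<Phi>_props(2)[of "-x"]]] by simp
  have l\<psi>': "((\<lambda>x. x ^ Suc q * (f x + f (- x))) \<longlongrightarrow> c) at_top"
  proof (rule tendsto_at_top_divide[OF _ tendsto_mult[OF G_lim G_lim_minus]])
    show "((\<lambda>x. (poly (pderiv F) x / x ^ n)\<^sup>2 * (x ^ q * poly E x / x ^ (2 * n + 1)) +
        (x ^ q * poly (pderiv D) x / x ^ n) * (poly (pderiv F) (- x) / x ^ n - poly (pderiv F) x / x ^ n)
        * (poly G x / x ^ (2 * n + 1))) \<longlongrightarrow>
       (real n + 1)\<^sup>2 * (2 * \<gamma>) + (2 * \<beta> * (real n + 1 - q)) * (- (real n + 1) - (real n + 1)) * (- A)) at_top"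
      by (intro tendsto_intros lE lD' F'_lim F'_lim_minus G_lim)
  next
    fix x :: real assume x: "x > 0"
    have G: "poly G x \<noteq> 0" "poly G (- x) \<noteq> 0" using x Q_neg[of x] Q_neg[of "-x"] by (auto simp: G_eq)
    define X Y g h u v where "X = poly (pderiv F) x" and "Y = poly (pderiv F) (- x)"
      and "g = poly G x" and "h = poly G (- x)" and "u = x ^ q" and "v = x ^ n"
    have uv: "u \<noteq> 0" "v \<noteq> 0" "g \<noteq> 0" "h \<noteq> 0" using x G by (auto simp: u_def v_def g_def h_def)
    have pw: "x ^ (2 * n + 1) = x * v\<^sup>2" "x ^ Suc q = x * u" by (simp_all add: u_def v_def power_mult mult.commute[of 2])
    have "x ^ Suc q * (f x + f (- x)) = x * u * (X\<^sup>2 / g + Y\<^sup>2 / h)"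
      by (simp add: u_def f_def X_def Y_def g_def h_def)
    \<comment> \<open>The numerator \<open>X\<^sup>2 * h + Y\<^sup>2 * g\<close> is rewritten as
      \<open>X\<^sup>2 * (g + h) + g * (X + Y) * (Y - X)\<close>, which isolates the cancelling sums
      \<open>g + h\<close> and \<open>X + Y\<close>, the values of \<open>E\<close> and of the
      derivative of \<open>D\<close>.\<close>
    also have "\<dots> = ((X / v)\<^sup>2 * (u * (g + h) / (x * v\<^sup>2)) + (u * (X + Y) / v) * (Y / v - X / v) * (g / (x * v\<^sup>2))) /
       (g / (x * v\<^sup>2) * (h / (x * v\<^sup>2)))"
      using uv x by (simp add: field_simps power2_eq_square)
    finally show "x ^ Suc q * (f x + f (- x)) =
      ((poly (pderiv F) x / x ^ n)\<^sup>2 * (x ^ q * poly E x / x ^ (2 * n + 1)) +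
        (x ^ q * poly (pderiv D) x / x ^ n) * (poly (pderiv F) (- x) / x ^ n - poly (pderiv F) x / x ^ n)
        * (poly G x / x ^ (2 * n + 1))) / (poly G x / x ^ (2 * n + 1) * (poly G (- x) / x ^ (2 * n + 1)))"
      unfolding poly_E poly_D' pw by (simp only: X_def Y_def g_def h_def u_def v_def)
  next
    show "c = ((real n + 1)\<^sup>2 * (2 * \<gamma>) + (2 * \<beta> * (real n + 1 - q)) * (- (real n + 1) - (real n + 1)) * (- A)) / (- A * A)"
      using A by (simp add: c_def field_simps power2_eq_square)
  qed (use A in auto)
  obtain L where L: "(\<psi> \<longlongrightarrow> L) at_top" "((\<lambda>x. (\<psi> x - L) * x ^ q) \<longlongrightarrow> - c / q) at_top"
    using tail_asymptotics[where \<psi> = \<psi>, OF D\<psi> l\<psi>' q] by blast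

  define \<rho> where "\<rho> y = y powr (1 / (real n + 1))" for y
  have Wpos: "pos.W y > 0" "neg.W y > 0" if "y > 0" for y
    using that pos.W_strict[of 0 y] neg.W_strict[of 0 y] by (auto simp: pos.W_def neg.W_def)
  \<comment> \<open>The mean value points are made into one function of \<open>y\<close>. Squeezed
    between the two branch coordinates, it is asymptotic to \<rho> and tends to infinity.\<close>
  have "\<exists>\<xi>. y > 0 \<longrightarrow> min (pos.W y) (neg.W y) \<le> \<xi> \<and> \<xi> \<le> max (pos.W y) (neg.W y) \<and>
     \<Phi> (pos.W y) - \<Phi> (neg.W y) = (poly F (pos.W y) - poly F (neg.W y)) * (poly (pderiv F) \<xi> / poly G \<xi>)" for y
    using \<Phi>_diff[OF Wpos, of y] by blast
  then obtain \<xi> where \<xi>: "\<And>y. y > 0 \<Longrightarrow> min (pos.W y) (neg.W y) \<le> \<xi> y \<and> \<xi> y \<le> max (pos.W y) (neg.W y) \<and>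
     \<Phi> (pos.W y) - \<Phi> (neg.W y) = (poly F (pos.W y) - poly F (neg.W y)) * (poly (pderiv F) (\<xi> y) / poly G (\<xi> y))"
    by metis
  have ratio_inv: "((\<lambda>y. neg.W y / \<rho> y) \<longlongrightarrow> 1) at_top" "((\<lambda>y. pos.W y / \<rho> y) \<longlongrightarrow> 1) at_top"
    using tendsto_inverse[OF W_ratio(1)] tendsto_inverse[OF W_ratio(2)] by (simp_all add: \<rho>_def)
  have \<xi>_ratio: "((\<lambda>y. \<xi> y / \<rho> y) \<longlongrightarrow> 1) at_top"
  proof (rule tendsto_sandwich)
    show "((\<lambda>y. min (pos.W y / \<rho> y) (neg.W y / \<rho> y)) \<longlongrightarrow> 1) at_top"
      using tendsto_min[OF ratio_inv(2,1)] by simp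
    show "((\<lambda>y. max (pos.W y / \<rho> y) (neg.W y / \<rho> y)) \<longlongrightarrow> 1) at_top"
      using tendsto_max[OF ratio_inv(2,1)] by simp
    show "eventually (\<lambda>y. min (pos.W y / \<rho> y) (neg.W y / \<rho> y) \<le> \<xi> y / \<rho> y) at_top"
      using eventually_gt_at_top[of 0]
    proof eventually_elim
      case (elim y)
      thus ?case using \<xi>[of y] by (auto simp: \<rho>_def min_le_iff_disj intro!: divide_right_mono)
    qed
    show "eventually (\<lambda>y. \<xi> y / \<rho> y \<le> max (pos.W y / \<rho> y) (neg.W y / \<rho> y)) at_top"
      using eventually_gt_at_top[of 0]
    proof eventually_elim
      case (elim y)
      thus ?case using \<xi>[of y] by (auto simp: \<rho>_def le_max_iff_disj intro!: divide_right_mono)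
    qed
  qed
  have \<xi>_top: "filterlim \<xi> at_top at_top"
  proof (rule filterlim_at_top_mono)
    show "filterlim (\<lambda>y. min (pos.W y) (neg.W y)) at_top at_top"
      using pos.W_top neg.W_top unfolding filterlim_at_top by (simp add: eventually_conj_iff)
    show "eventually (\<lambda>y. min (pos.W y) (neg.W y) \<le> \<xi> y) at_top"
      using eventually_gt_at_top[of 0] by eventually_elim (use \<xi> in blast)
  qed
  have lR: "((\<lambda>x. x ^ Suc n * (poly (pderiv F) x / poly G x)) \<longlongrightarrow> - (real n + 1) / A) at_top"
  proof (rule tendsto_at_top_divide[OF F'_lim G_lim])
    fix x :: real assume "x > 0"
    thus "x ^ Suc n * (poly (pderiv F) x / poly G x) = poly (pderiv F) x / x ^ n / (poly G x / x ^ (2 * n + 1))"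
      by (simp add: field_simps power_add mult_2 mult_2_right)
  qed (use A in \<open>auto simp: field_simps\<close>)
  have part1: "((\<lambda>y. (\<Phi> (pos.W y) - \<Phi> (neg.W y)) * \<rho> y ^ q) \<longlongrightarrow> 2 * \<beta> * (real n + 1) / A) at_top"
  proof -
    \<comment> \<open>Every factor is grouped so as to have a limit: \<open>D\<close> and
      \<open>F' / G\<close> are scaled by powers of their own arguments, and the ratios of these
      arguments to \<rho> tend to 1.\<close>
    have "((\<lambda>y. - (neg.W y ^ q * poly D (neg.W y) / neg.W y ^ Suc n) * (\<rho> y / neg.W y) ^ q *
        (neg.W y / \<rho> y) ^ Suc n / (\<xi> y / \<rho> y) ^ Suc n * (\<xi> y ^ Suc n * (poly (pderiv F) (\<xi> y) / poly G (\<xi> y))))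
        \<longlongrightarrow> - (2 * \<beta>) * 1 ^ q * 1 ^ Suc n / 1 ^ Suc n * (- (real n + 1) / A)) at_top"
      using W_ratio(2)
      by (intro tendsto_mult tendsto_divide tendsto_power tendsto_minus ratio_inv \<xi>_ratio
           filterlim_compose[OF lD neg.W_top] filterlim_compose[OF lR \<xi>_top]) (auto simp: \<rho>_def)
    moreover have "eventually (\<lambda>y. - (neg.W y ^ q * poly D (neg.W y) / neg.W y ^ Suc n) * (\<rho> y / neg.W y) ^ q *
        (neg.W y / \<rho> y) ^ Suc n / (\<xi> y / \<rho> y) ^ Suc n * (\<xi> y ^ Suc n * (poly (pderiv F) (\<xi> y) / poly G (\<xi> y)))
        = (\<Phi> (pos.W y) - \<Phi> (neg.W y)) * \<rho> y ^ q) at_top"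
      using eventually_gt_at_top[of 0]
    proof eventually_elim
      case (elim y)
      have p: "neg.W y > 0" "\<rho> y > 0" "\<xi> y > 0"
        using Wpos[OF elim] elim \<xi>[OF elim] by (auto simp: \<rho>_def min_le_iff_disj)
      have "poly F (pos.W y) - poly F (neg.W y) = - poly D (neg.W y)"
        using pos.W_props[of y] neg.W_props[of y] elim by (simp add: poly_D)
      hence "\<Phi> (pos.W y) - \<Phi> (neg.W y) = - poly D (neg.W y) * (poly (pderiv F) (\<xi> y) / poly G (\<xi> y))"
        using \<xi>[OF elim] by simp
      thus ?case using p by (simp add: power_divide del: power_Suc)
    qed
    moreover have "- (2 * \<beta>) * 1 ^ q * 1 ^ Suc n / 1 ^ Suc n * (- (real n + 1) / A) = 2 * \<beta> * (real n + 1) / A"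
      using A by (simp add: field_simps)
    ultimately show ?thesis by (simp only: Lim_transform_eventually)
  qed
  have part2: "((\<lambda>y. (\<psi> (neg.W y) - L) * \<rho> y ^ q) \<longlongrightarrow> - c / q) at_top"
  proof -
    have "((\<lambda>y. (\<psi> (neg.W y) - L) * neg.W y ^ q * (\<rho> y / neg.W y) ^ q) \<longlongrightarrow> - c / q * 1 ^ q) at_top"
      using W_ratio(2)
      by (intro tendsto_mult tendsto_power filterlim_compose[OF L(2) neg.W_top]) (auto simp: \<rho>_def)
    moreover have "eventually (\<lambda>y. (\<psi> (neg.W y) - L) * neg.W y ^ q * (\<rho> y / neg.W y) ^ q = (\<psi> (neg.W y) - L) * \<rho> y ^ q) at_top"
      using eventually_gt_at_top[of 0]
    proof eventually_elim
      case (elim y)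
      thus ?case using Wpos[OF elim] by (simp add: power_divide)
    qed
    ultimately show ?thesis by (simp add: tendsto_cong)
  qed
  \<comment> \<open>Inside the bracket the mean value term gives \<open>\<beta> * q\<close> and the
    tail gives \<open>2 * \<beta> * (n + 1 - q)\<close>. Their sum is the origin of
    \<open>2 * n + 2 - q\<close>, which is \<open>n + 2 * j_b + 2\<close> at
    \<open>q = n - 2 * j_b\<close>.\<close>
  have val: "2 * \<beta> * (real n + 1) / A + - c / q =
     2 * (real n + 1) / (A * q) * (\<beta> * (2 * real n + 2 - q) + \<gamma> * (real n + 1) / A)"
    using A q by (simp add: c_def field_simps power2_eq_square)
  have eq: "eventually (\<lambda>y. (\<Phi> (pos.W y) - \<Phi> (neg.W y)) * \<rho> y ^ q + (\<psi> (neg.W y) - L) * \<rho> y ^ q =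
       (slow_div_int F G y - L) * \<rho> y ^ q) at_top"
    using eventually_gt_at_top[of 0]
  proof eventually_elim
    case (elim y)
    thus ?case by (simp add: slow_div_int_def I_minus_eq I_plus_eq pos.J_def neg.J_def \<psi>_def algebra_simps)
  qed
  have main: "((\<lambda>y. (slow_div_int F G y - L) * \<rho> y ^ q) \<longlongrightarrow>
      2 * (real n + 1) / (A * q) * (\<beta> * (2 * real n + 2 - q) + \<gamma> * (real n + 1) / A)) at_top"
    using tendsto_add[OF part1 part2] unfolding val tendsto_cong[OF eq] .
  \<comment> \<open>As \<rho> tends to infinity, the rate just found forces
    \<open>slow_div_int F G y - L\<close> itself to tend to 0.\<close>
  have "filterlim (\<lambda>y. \<rho> y / pos.W y * pos.W y) at_top at_top"
    using W_ratio(1) pos.W_top unfolding \<rho>_def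
    by (intro filterlim_tendsto_pos_mult_at_top[where c = 1]) auto
  moreover have "eventually (\<lambda>y. \<rho> y / pos.W y * pos.W y = \<rho> y) at_top"
    using eventually_gt_at_top[of 0] by eventually_elim (use Wpos in force)
  ultimately have "filterlim \<rho> at_top at_top" by (simp add: filterlim_cong)
  hence "filterlim (\<lambda>y. \<rho> y ^ q) at_top at_top" using q by (intro filterlim_pow_at_top) auto
  from real_tendsto_divide_at_top[OF main this]
  have "((\<lambda>y. (slow_div_int F G y - L) * \<rho> y ^ q / \<rho> y ^ q) \<longlongrightarrow> 0) at_top" .
  moreover have "eventually (\<lambda>y. (slow_div_int F G y - L) * \<rho> y ^ q / \<rho> y ^ q = slow_div_int F G y - L) at_top"
    using eventually_gt_at_top[of 0] by eventually_elim (simp add: \<rho>_def)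
  ultimately have "((\<lambda>y. slow_div_int F G y - L) \<longlongrightarrow> 0) at_top" by (simp add: tendsto_cong)
  hence "(slow_div_int F G \<longlongrightarrow> L) at_top" by (simp add: LIM_zero_iff)
  with main show ?thesis unfolding \<rho>_def by (intro that)
qed

end

section \<open>Orbits of the slow relation and of its inverse for the polynomial system\<close>

context lienard
begin

lemma slow_div_int_eq: "0 \<le> y \<Longrightarrow> slow_div_int F G y = pos.J y - neg.J y"
  by (simp add: slow_div_int_def I_minus_eq I_plus_eq)

lemma slow_rel_props:
  assumes "0 \<le> y"
  shows "0 \<le> slow_rel F G y \<and> neg.J (slow_rel F G y) = pos.J y"
proof -
  have "pos.J y \<le> 0" using pos.J_mono[OF order_refl assms] by (simp add: pos.J_0)
  then obtain z where z: "0 \<le> z" "neg.J z = pos.J y" by (rule neg.J_surj)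
  have "slow_rel F G y = z" unfolding slow_rel_def I_minus_eq
    using z neg.J_inj by (intro the_equality) (auto simp: I_plus_eq)
  thus ?thesis using z by simp
qed

lemma slow_rel_inv_props:
  assumes "0 \<le> y"
  shows "0 \<le> slow_rel_inv F G y \<and> pos.J (slow_rel_inv F G y) = neg.J y"
proof -
  have "neg.J y \<le> 0" using neg.J_mono[OF order_refl assms] by (simp add: neg.J_0)
  then obtain z where z: "0 \<le> z" "pos.J z = neg.J y" by (rule pos.J_surj)
  have "inj_on (slow_rel F G) {0..}"
  proof (rule inj_onI)
    fix x y assume "x \<in> {0..}" "y \<in> {0..}" "slow_rel F G x = slow_rel F G y"
    thus "x = y" using slow_rel_props[of x] slow_rel_props[of y] pos.J_inj[of x y] by simp
  qed
  moreover have "slow_rel F G z = y"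
    using neg.J_inj[of "slow_rel F G z" y] slow_rel_props[OF z(1)] z(2) assms by simp
  ultimately have "slow_rel_inv F G y = z"
    unfolding slow_rel_inv_def using z(1) by (intro the_inv_into_f_eq) auto
  thus ?thesis using z by simp
qed

lemma log_regular_slow_rel: "\<exists>K1 K2 M0. log_regular_relation pos.J neg.J (slow_rel F G) K1 K2 M0"
proof -
  obtain M where "M > 0"
    "\<And>y z. M \<le> y \<Longrightarrow> y \<le> z \<Longrightarrow> (real n + 1) / A / 2 * (ln z - ln y) \<le> neg.J y - neg.J z \<and>
       neg.J y - neg.J z \<le> 2 * ((real n + 1) / A) * (ln z - ln y)"
    using neg.J_log_bounds by blast
  hence "log_regular_relation pos.J neg.J (slow_rel F G) ((real n + 1) / A / 2) (2 * ((real n + 1) / A)) M"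
    using A slow_rel_props neg.J_mono by unfold_locales auto
  thus ?thesis by blast
qed

lemma log_regular_slow_rel_inv: "\<exists>K1 K2 M0. log_regular_relation neg.J pos.J (slow_rel_inv F G) K1 K2 M0"
proof -
  obtain M where "M > 0"
    "\<And>y z. M \<le> y \<Longrightarrow> y \<le> z \<Longrightarrow> (real n + 1) / A / 2 * (ln z - ln y) \<le> pos.J y - pos.J z \<and>
       pos.J y - pos.J z \<le> 2 * ((real n + 1) / A) * (ln z - ln y)"
    using pos.J_log_bounds by blast
  hence "log_regular_relation neg.J pos.J (slow_rel_inv F G) ((real n + 1) / A / 2) (2 * ((real n + 1) / A)) M"
    using A slow_rel_inv_props pos.J_mono by unfold_locales auto
  thus ?thesis by blast
qed

lemma J_diff_lim:
  assumes "((\<lambda>y. slow_div_int F G y * g y) \<longlongrightarrow> c) at_top"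
  shows "((\<lambda>y. (pos.J y - neg.J y) * g y) \<longlongrightarrow> c) at_top"
        "((\<lambda>y. (neg.J y - pos.J y) * g y) \<longlongrightarrow> - c) at_top"
proof -
  have ev: "eventually (\<lambda>y. slow_div_int F G y * g y = (pos.J y - neg.J y) * g y) at_top"
    using eventually_ge_at_top[of 0] by eventually_elim (simp add: slow_div_int_eq)
  show 1: "((\<lambda>y. (pos.J y - neg.J y) * g y) \<longlongrightarrow> c) at_top"
    by (rule Lim_transform_eventually[OF assms ev])
  show "((\<lambda>y. (neg.J y - pos.J y) * g y) \<longlongrightarrow> - c) at_top"
    using tendsto_minus[OF 1] by (simp add: algebra_simps)
qed

lemma escapes_dim_0:
  assumes lim: "(slow_div_int F G \<longlongrightarrow> L) at_top"
  shows "L < 0 \<Longrightarrow> for_all_suff_large (\<lambda>y0. escapes_with_dim n (orbit_seq (slow_rel F G) y0) 0)"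
        "L > 0 \<Longrightarrow> for_all_suff_large (\<lambda>y0. escapes_with_dim n (orbit_seq (slow_rel_inv F G) y0) 0)"
proof -
  note lims = J_diff_lim[where g = "\<lambda>_. 1", simplified, OF lim]
  show "for_all_suff_large (\<lambda>y0. escapes_with_dim n (orbit_seq (slow_rel F G) y0) 0)" if "L < 0"
    using log_regular_slow_rel log_regular_relation.escapes_with_dim_0 lims(1) that by blast
  show "for_all_suff_large (\<lambda>y0. escapes_with_dim n (orbit_seq (slow_rel_inv F G) y0) 0)" if "L > 0"
    using log_regular_slow_rel_inv log_regular_relation.escapes_with_dim_0[OF _ lims(2)] that by fastforce
qed

text \<open>\<kappa> is the constant of the asymptotics without the positive factor
  \<open>2 * (n + 1) / (A * q)\<close>. When nonzero, its sign is that of \<open>I\<close> near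
  infinity and decides whether \<open>S\<close> or its inverse moves points upwards.\<close>

lemma escapes_leading_coeff:
  assumes q: "q \<ge> 1" "odd q"
    and F_odd: "\<And>i. odd i \<Longrightarrow> i + q > n + 1 \<Longrightarrow> coeff F i = 0"
    and G_even: "\<And>i. even i \<Longrightarrow> i + q > 2 * n + 1 \<Longrightarrow> coeff G i = 0"
    and lim: "(slow_div_int F G \<longlongrightarrow> 0) at_top"
    and \<kappa>: "\<kappa> = (if q \<le> n + 1 then coeff F (n + 1 - q) else 0) * (2 * real n + 2 - q) +
              (if q \<le> 2 * n + 1 then coeff G (2 * n + 1 - q) else 0) * (real n + 1) / A"
    and d: "d = real q / (real q + 1)"
  shows "\<kappa> < 0 \<Longrightarrow> for_all_suff_large (\<lambda>y0. escapes_nondegenerately n (orbit_seq (slow_rel F G) y0) d)"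
        "\<kappa> > 0 \<Longrightarrow> for_all_suff_large (\<lambda>y0. escapes_nondegenerately n (orbit_seq (slow_rel_inv F G) y0) d)"
proof -
  define c where "c = 2 * (real n + 1) / (A * q) * \<kappa>"
  obtain L where L: "(slow_div_int F G \<longlongrightarrow> L) at_top"
    "((\<lambda>y. (slow_div_int F G y - L) * (y powr (1 / (real n + 1))) ^ q) \<longlongrightarrow> c) at_top"
    using slow_div_int_asymptotics[OF q(1) F_odd G_even q(2)] unfolding c_def \<kappa> by blast
  have "L = 0" using tendsto_unique[OF _ L(1) lim] by simp
  with L(2) have lim': "((\<lambda>y. slow_div_int F G y * (y powr (1 / (real n + 1))) ^ q) \<longlongrightarrow> c) at_top" by simp
  note lims = J_diff_lim[OF lim']
  have sgn: "2 * (real n + 1) / (A * q) > 0" using A q by (intro divide_pos_pos mult_pos_pos) auto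
  show "for_all_suff_large (\<lambda>y0. escapes_nondegenerately n (orbit_seq (slow_rel F G) y0) d)" if "\<kappa> < 0"
  proof -
    have "c < 0" unfolding c_def using sgn that by (rule mult_pos_neg)
    thus ?thesis unfolding d
      using log_regular_slow_rel log_regular_relation.escapes_nondegenerately_power[OF _ lims(1) _ q(1)] by blast
  qed
  show "for_all_suff_large (\<lambda>y0. escapes_nondegenerately n (orbit_seq (slow_rel_inv F G) y0) d)" if "\<kappa> > 0"
  proof -
    have "c > 0" unfolding c_def using sgn that by (rule mult_pos_pos)
    hence "- c < 0" by simp
    thus ?thesis unfolding d
      using log_regular_slow_rel_inv log_regular_relation.escapes_nondegenerately_power[OF _ lims(2) _ q(1)] by blast
  qed
qed

end

section \<open>Extremal coefficient indices and the case distinction on the exponents\<close>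

lemma j_b_props:
  assumes "j_b_defined n b"
  shows "2 * j_b n b + 1 \<le> n" "2 * j + 1 \<le> n \<Longrightarrow> j > j_b n b \<Longrightarrow> b (2 * j + 1) = 0"
proof -
  define S where "S = {j. 2 * j + 1 \<le> n \<and> b (2 * j + 1) \<noteq> 0}"
  have S: "finite S" "S \<noteq> {}" "j_b n b = Max S"
    using assms by (auto simp: S_def j_b_defined_def j_b_def intro: finite_subset[of _ "{..n}"])
  show "2 * j_b n b + 1 \<le> n" using Max_in[OF S(1,2)] S(3) by (simp add: S_def)
  show "b (2 * j + 1) = 0" if "2 * j + 1 \<le> n" "j > j_b n b"
    using Max_ge[OF S(1), of j] S(3) that by (force simp: S_def)
qed

lemma j_a_props:
  assumes "j_a_defined m a"
  shows "2 * j_a m a + 1 \<le> m" "2 * j + 1 \<le> m \<Longrightarrow> j > j_a m a \<Longrightarrow> a (2 * j) = 0"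
proof -
  define S where "S = {j. 2 * j + 1 \<le> m \<and> a (2 * j) \<noteq> 0}"
  have S: "finite S" "S \<noteq> {}" "j_a m a = Max S"
    using assms by (auto simp: S_def j_a_defined_def j_a_def intro: finite_subset[of _ "{..m}"])
  show "2 * j_a m a + 1 \<le> m" using Max_in[OF S(1,2)] S(3) by (simp add: S_def)
  show "a (2 * j) = 0" if "2 * j + 1 \<le> m" "j > j_a m a"
    using Max_ge[OF S(1), of j] S(3) that by (force simp: S_def)
qed

lemma poly_div_X:
  fixes p :: "real poly"
  assumes "poly p 0 = 0"
  shows "poly p x = x * poly (p div [:0, 1:]) x"
proof -
  have "[:0, 1:] dvd p" using assms poly_eq_0_iff_dvd[of p 0] by simp
  then obtain k where k: "p = [:0, 1:] * k" by (rule dvdE)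
  have "p div [:0, 1:] = k" unfolding k by (rule nonzero_mult_div_cancel_left) simp
  thus ?thesis by (simp add: k)
qed

text \<open>The sign of \<open>A\<close> and the parity of \<open>n\<close> are read off from
  limits: \<open>G < 0\<close> on the positive axis gives \<open>- A \<le> 0\<close>, and
  \<open>F' < 0\<close> on the negative axis gives
  \<open>(-1) ^ n * (n + 1) \<le> 0\<close>.\<close>

lemma lienardI:
  fixes n m :: nat and A :: real and F G :: "real poly"
  assumes A: "A \<noteq> 0"
    and F: "F = monom 1 (n + 1) + (\<Sum>k\<le>n. monom (b k) k)"
    and G: "G = - monom A (2 * n + 1) - (\<Sum>k<2 * n + 1. monom (a k) k)"
    and F0: "poly F 0 = 0" "poly (pderiv F) 0 = 0"
    and F_pos: "\<forall>x. poly (pderiv F div [:0, 1:]) x > 0"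
    and G0: "poly G 0 = 0"
    and G_neg: "\<forall>x. poly (G div [:0, 1:]) x < 0"
  shows "lienard n A F G (pderiv F div [:0, 1:]) (G div [:0, 1:])"
    and "coeff F i = (if i = n + 1 then 1 else if i \<le> n then b i else 0)"
    and "coeff G i = (if i = 2 * n + 1 then - A else if i < 2 * n + 1 then - a i else 0)"
proof -
  have cF: "coeff F i = (if i = n + 1 then 1 else if i \<le> n then b i else 0)" for i
    by (auto simp: F coeff_sum)
  have cG: "coeff G i = (if i = 2 * n + 1 then - A else if i < 2 * n + 1 then - a i else 0)" for i
    by (auto simp: G coeff_sum)
  note F' = poly_div_X[OF F0(2)] and G' = poly_div_X[OF G0]
  have "((\<lambda>x. poly G (1 * x) / x ^ (2 * n + 1)) \<longlongrightarrow> 1 ^ (2 * n + 1) * coeff G (2 * n + 1)) at_top"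
    by (rule poly_over_power_tendsto) (simp add: cG)
  moreover have "eventually (\<lambda>x. poly G (1 * x) / x ^ (2 * n + 1) \<le> 0) at_top"
    using eventually_gt_at_top[of 0]
  proof eventually_elim
    case (elim x)
    have "poly G x < 0" using G'[of x] G_neg elim by (simp add: mult_pos_neg)
    thus ?case using elim by (simp add: divide_nonpos_pos)
  qed
  ultimately have "1 ^ (2 * n + 1) * coeff G (2 * n + 1) \<le> 0" by (rule tendsto_upperbound) simp
  hence "A > 0" using A by (simp add: cG)
  have "((\<lambda>x. poly (pderiv F) (-1 * x) / x ^ n) \<longlongrightarrow> (-1) ^ n * coeff (pderiv F) n) at_top"
    by (rule poly_over_power_tendsto) (simp add: cF coeff_pderiv)
  moreover have "eventually (\<lambda>x. poly (pderiv F) (-1 * x) / x ^ n \<le> 0) at_top"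
    using eventually_gt_at_top[of 0]
  proof eventually_elim
    case (elim x)
    have "poly (pderiv F) (-x) < 0" using F'[of "-x"] F_pos elim by (simp add: mult_pos_pos)
    thus ?case using elim by (simp add: divide_nonpos_pos)
  qed
  ultimately have "(-1) ^ n * coeff (pderiv F) n \<le> 0" by (rule tendsto_upperbound) simp
  hence "odd n" by (cases "even n") (auto simp: coeff_pderiv cF)
  show "lienard n A F G (pderiv F div [:0, 1:]) (G div [:0, 1:])"
    by unfold_locales (use \<open>odd n\<close> \<open>A > 0\<close> F0 F' G' F_pos G_neg in \<open>auto simp: cF cG\<close>)
  show "coeff F i = (if i = n + 1 then 1 else if i \<le> n then b i else 0)" by (rule cF)
  show "coeff G i = (if i = 2 * n + 1 then - A else if i < 2 * n + 1 then - a i else 0)" by (rule cG)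
qed

theorem theorem2p2:
  fixes n m :: nat and A :: real and a b :: "nat \<Rightarrow> real" and F G :: "real poly"
  assumes n: "n \<ge> 1" and m: "m \<ge> 1" and A: "A \<noteq> 0"
    and F: "F = monom 1 (n + 1) + (\<Sum>k\<le>n. monom (b k) k)"
    and G: "G = - monom A m - (\<Sum>k<m. monom (a k) k)"
    and F0: "poly F 0 = 0" "poly (pderiv F) 0 = 0"
    and F_pos: "\<forall>x. poly (pderiv F div [:0, 1:]) x > 0"
    and G0: "poly G 0 = 0"
    and G_neg: "\<forall>x. poly (G div [:0, 1:]) x < 0"
    and defined: "j_a_defined m a \<or> j_b_defined n b"
    and mn: "m = 2 * n + 1"
  shows "\<exists>Istar :: real. (slow_div_int F G \<longlongrightarrow> Istar) at_top \<and>
    \<comment> \<open>1\<close>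
    (Istar < 0 \<longrightarrow> for_all_suff_large (\<lambda>y0.
       escapes_with_dim n (orbit_seq (slow_rel F G) y0) 0)) \<and>
    (Istar > 0 \<longrightarrow> for_all_suff_large (\<lambda>y0.
       escapes_with_dim n (orbit_seq (slow_rel_inv F G) y0) 0)) \<and>
    \<comment> \<open>2\<close>
    ((j_a_defined m a \<and> j_b_defined n b \<and>
        int n - 2 * int (j_b n b) < 2 * int n + 1 - 2 * int (j_a m a)
      \<or> \<not> j_a_defined m a) \<and> Istar = 0 \<longrightarrow>
     (let d = (real n - 2 * real (j_b n b)) / (real n + 1 - 2 * real (j_b n b)) in
       (b (2 * j_b n b + 1) < 0 \<longrightarrow> for_all_suff_large (\<lambda>y0.
          escapes_nondegenerately n (orbit_seq (slow_rel F G) y0) d)) \<and>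
       (b (2 * j_b n b + 1) > 0 \<longrightarrow> for_all_suff_large (\<lambda>y0.
          escapes_nondegenerately n (orbit_seq (slow_rel_inv F G) y0) d)))) \<and>
    \<comment> \<open>3\<close>
    ((j_a_defined m a \<and> j_b_defined n b \<and>
        int n - 2 * int (j_b n b) > 2 * int n + 1 - 2 * int (j_a m a)
      \<or> \<not> j_b_defined n b) \<and> Istar = 0 \<longrightarrow>
     (let d = (2 * real n + 1 - 2 * real (j_a m a)) / (2 * real n + 2 - 2 * real (j_a m a)) in
       (a (2 * j_a m a) > 0 \<longrightarrow> for_all_suff_large (\<lambda>y0.
          escapes_nondegenerately n (orbit_seq (slow_rel F G) y0) d)) \<and>
       (a (2 * j_a m a) < 0 \<longrightarrow> for_all_suff_large (\<lambda>y0.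
          escapes_nondegenerately n (orbit_seq (slow_rel_inv F G) y0) d)))) \<and>
    \<comment> \<open>4\<close>
    (let C = b (2 * j_b n b + 1) * (real n + 2 * real (j_b n b) + 2)
               - a (2 * j_a m a) * ((real n + 1) / A);
         d = (real n - 2 * real (j_b n b)) / (real n + 1 - 2 * real (j_b n b)) in
     j_a_defined m a \<and> j_b_defined n b \<and>
       int n - 2 * int (j_b n b) = 2 * int n + 1 - 2 * int (j_a m a) \<and> C \<noteq> 0 \<and> Istar = 0 \<longrightarrow>
       (C < 0 \<longrightarrow> for_all_suff_large (\<lambda>y0.
          escapes_nondegenerately n (orbit_seq (slow_rel F G) y0) d)) \<and>
       (C > 0 \<longrightarrow> for_all_suff_large (\<lambda>y0.
          escapes_nondegenerately n (orbit_seq (slow_rel_inv F G) y0) d)))"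
proof -
  note base = lienardI[OF A F G[unfolded mn] F0 F_pos G0 G_neg]
  define P Q where "P = pderiv F div [:0, 1:]" and "Q = G div [:0, 1:]"
  interpret lienard n A F G P Q unfolding P_def Q_def by (rule base(1))
  note cF = base(2) and cG = base(3)
  have A_pos: "A > 0" and odd_n: "odd n" using lienard_axioms by (auto simp: lienard_def)
  have b_def: "j_b_defined n b \<Longrightarrow> 2 * j_b n b + 1 \<le> n"
    and b_zero: "\<And>k. j_b_defined n b \<Longrightarrow> 2 * k + 1 \<le> n \<Longrightarrow> k > j_b n b \<Longrightarrow> b (2 * k + 1) = 0"
    and b_undef: "\<And>k. \<not> j_b_defined n b \<Longrightarrow> 2 * k + 1 \<le> n \<Longrightarrow> b (2 * k + 1) = 0"
    using j_b_props by (auto simp: j_b_defined_def)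
  have a_def: "j_a_defined m a \<Longrightarrow> 2 * j_a m a + 1 \<le> m"
    and a_zero: "\<And>k. j_a_defined m a \<Longrightarrow> 2 * k + 1 \<le> m \<Longrightarrow> k > j_a m a \<Longrightarrow> a (2 * k) = 0"
    and a_undef: "\<And>k. \<not> j_a_defined m a \<Longrightarrow> 2 * k + 1 \<le> m \<Longrightarrow> a (2 * k) = 0"
    using j_a_props by (auto simp: j_a_defined_def)
  \<comment> \<open>The bound on \<open>q\<close> is required only if \<open>j_b\<close> is defined;
    otherwise all odd coefficients vanish and every \<open>q\<close> is admissible.
    \<open>G_even\<close> follows the same pattern.\<close>
  have F_odd: "coeff F i = 0"
    if i: "odd i" "i + q > n + 1" and q: "j_b_defined n b \<Longrightarrow> q + 2 * j_b n b \<le> n" for i q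
  proof -
    obtain k where k: "i = 2 * k + 1" using i(1) by (rule oddE)
    have "b (2 * k + 1) = 0" if "2 * k + 1 \<le> n"
    proof (cases "j_b_defined n b")
      case True
      have "k > j_b n b" using q[OF True] i(2) k by linarith
      thus ?thesis by (rule b_zero[OF True that])
    qed (rule b_undef[OF _ that])
    moreover have "i \<noteq> n + 1" using i(1) odd_n by auto
    ultimately show ?thesis using k by (auto simp: cF)
  qed
  have G_even: "coeff G i = 0"
    if i: "even i" "i + q > 2 * n + 1" and q: "j_a_defined m a \<Longrightarrow> q + 2 * j_a m a \<le> 2 * n + 1" for i q
  proof -
    obtain k where k: "i = 2 * k" using i(1) by (rule evenE)
    have "a (2 * k) = 0" if "2 * k + 1 \<le> m"
    proof (cases "j_a_defined m a")
      case True
      have "k > j_a m a" using q[OF True] i(2) k by linarith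
      thus ?thesis by (rule a_zero[OF True that])
    qed (rule a_undef[OF _ that])
    moreover have "i \<noteq> 2 * n + 1" using i(1) by auto
    ultimately show ?thesis using k mn by (auto simp: cG)
  qed
  have F1: "coeff F i = 0" if "odd i" "i + 1 > n + 1" for i using F_odd[OF that] b_def by fastforce
  have G1: "coeff G i = 0" if "even i" "i + 1 > 2 * n + 1" for i using G_even[OF that] a_def mn by fastforce
  obtain Istar where Istar: "(slow_div_int F G \<longlongrightarrow> Istar) at_top"
    by (rule slow_div_int_asymptotics[OF order_refl F1 G1 odd_one])
  \<comment> \<open>Serves items 2 and 4: \<open>q = n - 2 * j_b\<close> is the smaller exponent or
    ties, and \<gamma> is the coefficient of \<open>G\<close> of the same order, which is 0 in item
    2 and \<open>- a (2 * j_a m a)\<close> in item 4.\<close>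
  have case_b: "(b (2 * j_b n b + 1) * (real n + 2 * real (j_b n b) + 2) + \<gamma> * (real n + 1) / A < 0 \<longrightarrow>
        for_all_suff_large (\<lambda>y0. escapes_nondegenerately n (orbit_seq (slow_rel F G) y0) d)) \<and>
      (b (2 * j_b n b + 1) * (real n + 2 * real (j_b n b) + 2) + \<gamma> * (real n + 1) / A > 0 \<longrightarrow>
        for_all_suff_large (\<lambda>y0. escapes_nondegenerately n (orbit_seq (slow_rel_inv F G) y0) d))"
    if jb: "j_b_defined n b" and ja: "j_a_defined m a \<longrightarrow> n + 2 * j_a m a \<le> 2 * n + 1 + 2 * j_b n b"
      and 0: "Istar = 0" and \<gamma>: "\<gamma> = coeff G (n + 1 + 2 * j_b n b)"
      and d: "d = (real n - 2 * real (j_b n b)) / (real n + 1 - 2 * real (j_b n b))" for \<gamma> d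
  proof -
    define q where "q = n - 2 * j_b n b"
    have q: "q + 2 * j_b n b = n" "q \<ge> 1" "odd q" using b_def[OF jb] odd_n by (auto simp: q_def)
    have ja': "q + 2 * j_a m a \<le> 2 * n + 1" if "j_a_defined m a" using ja that q(1) by linarith
    have rq: "real q = real n - 2 * real (j_b n b)" using q(1) by linarith
    have ind: "n + 1 - q = 2 * j_b n b + 1" "2 * n + 1 - q = n + 1 + 2 * j_b n b" "q \<le> n + 1" "q \<le> 2 * n + 1"
      using q(1) by linarith+
    have \<kappa>: "b (2 * j_b n b + 1) * (real n + 2 * real (j_b n b) + 2) + \<gamma> * (real n + 1) / A =
      (if q \<le> n + 1 then coeff F (n + 1 - q) else 0) * (2 * real n + 2 - q) +
              (if q \<le> 2 * n + 1 then coeff G (2 * n + 1 - q) else 0) * (real n + 1) / A"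
      using ind(3,4) b_def[OF jb] unfolding ind(1,2) \<gamma> rq by (simp add: cF)
    have d': "d = real q / (real q + 1)" by (simp add: d rq)
    have Fo: "coeff F i = 0" if "odd i" "i + q > n + 1" for i using F_odd[OF that] q(1) by simp
    have Ge: "coeff G i = 0" if "even i" "i + q > 2 * n + 1" for i using G_even[OF that] ja' by simp
    show ?thesis
      using escapes_leading_coeff[OF q(2,3) Fo Ge Istar[unfolded 0] \<kappa> d'] by blast
  qed
  have case_a: "(a (2 * j_a m a) > 0 \<longrightarrow>
        for_all_suff_large (\<lambda>y0. escapes_nondegenerately n (orbit_seq (slow_rel F G) y0) d)) \<and>
      (a (2 * j_a m a) < 0 \<longrightarrow>
        for_all_suff_large (\<lambda>y0. escapes_nondegenerately n (orbit_seq (slow_rel_inv F G) y0) d))"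
    if ja: "j_a_defined m a" and jb: "j_b_defined n b \<longrightarrow> n + 2 * j_a m a > 2 * n + 1 + 2 * j_b n b"
      and 0: "Istar = 0"
      and d: "d = (2 * real n + 1 - 2 * real (j_a m a)) / (2 * real n + 2 - 2 * real (j_a m a))" for d
  proof -
    define q where "q = 2 * n + 1 - 2 * j_a m a"
    have q: "q + 2 * j_a m a = 2 * n + 1" "q \<ge> 1" using a_def[OF ja] mn by (auto simp: q_def)
    have "odd (q + 2 * j_a m a)" unfolding q(1) by simp
    hence q_odd: "odd q" by simp
    have jb': "q + 2 * j_b n b < n" if "j_b_defined n b" using jb that q(1) by linarith
    have rq: "real q = 2 * real n + 1 - 2 * real (j_a m a)" using q(1) by linarith
    \<comment> \<open>A strictly smaller exponent for \<open>G\<close> leaves \<open>F\<close> no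
      contribution at this order: for \<open>q \<le> n\<close> the index \<open>n + 1 - q\<close> is
      odd and, if \<open>j_b\<close> is defined, exceeds \<open>2 * j_b + 1\<close>;
      \<open>q = n + 1\<close> is excluded by parity.\<close>
    have F0': "(if q \<le> n + 1 then coeff F (n + 1 - q) else 0) = 0"
    proof (cases "q \<le> n")
      case True
      hence "odd (n + 1 - q)" using q_odd odd_n by auto
      then obtain k where k: "n + 1 - q = 2 * k + 1" by (rule oddE)
      have k2: "2 * k + q = n" using k True by linarith
      have "b (2 * k + 1) = 0"
      proof (cases "j_b_defined n b")
        case True
        thus ?thesis using jb'[OF True] k2 q(2) by (intro b_zero) auto
      next
        case False
        thus ?thesis using k2 q(2) by (intro b_undef) auto
      qed
      hence "coeff F (2 * k + 1) = 0" using k2 q(2) by (simp add: cF)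
      thus ?thesis by (simp only: k if_cancel)
    next
      case False
      moreover have "q \<noteq> n + 1" using q_odd odd_n even_plus_one_iff by metis
      ultimately show ?thesis by simp
    qed
    have ind: "2 * n + 1 - q = 2 * j_a m a" "q \<le> 2 * n + 1" "2 * j_a m a < 2 * n + 1"
      using q by linarith+
    have \<kappa>: "- a (2 * j_a m a) * (real n + 1) / A =
      (if q \<le> n + 1 then coeff F (n + 1 - q) else 0) * (2 * real n + 2 - q) +
              (if q \<le> 2 * n + 1 then coeff G (2 * n + 1 - q) else 0) * (real n + 1) / A"
      unfolding F0' ind(1) using ind(2,3) by (simp add: cG)
    have d': "d = real q / (real q + 1)" by (simp add: d rq)
    have Fo: "coeff F i = 0" if "odd i" "i + q > n + 1" for i using F_odd[OF that] jb' by fastforce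
    have Ge: "coeff G i = 0" if "even i" "i + q > 2 * n + 1" for i using G_even[OF that] q(1) by simp
    have "- a (2 * j_a m a) * (real n + 1) / A < 0" if "a (2 * j_a m a) > 0"
      using that A_pos by (simp add: divide_neg_pos)
    moreover have "- a (2 * j_a m a) * (real n + 1) / A > 0" if "a (2 * j_a m a) < 0"
      using that A_pos by (intro divide_pos_pos mult_pos_pos) auto
    ultimately show ?thesis
      using escapes_leading_coeff[OF q(2) q_odd Fo Ge Istar[unfolded 0] \<kappa> d'] by blast
  qed
  have G_top: "coeff G (n + 1 + 2 * j_b n b) = 0"
    if "j_b_defined n b" "j_a_defined m a \<longrightarrow> n + 2 * j_a m a < 2 * n + 1 + 2 * j_b n b"
  proof -
    have ev: "even (n + 1 + 2 * j_b n b)" using odd_n by simp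
    \<comment> \<open>By strictness of the comparison, the exponent \<open>n + 1 - 2 * j_b\<close>,
      one larger than the governing one, is still admissible in \<open>G_even\<close>; that makes
      the coefficient at \<open>n + 1 + 2 * j_b\<close> vanish.\<close>
    have gt: "n + 1 + 2 * j_b n b + (n + 1 - 2 * j_b n b) > 2 * n + 1" using b_def[OF that(1)] by linarith
    have "n + 1 - 2 * j_b n b + 2 * j_a m a \<le> 2 * n + 1" if ja: "j_a_defined m a"
      using \<open>j_a_defined m a \<longrightarrow> n + 2 * j_a m a < 2 * n + 1 + 2 * j_b n b\<close> ja b_def[OF \<open>j_b_defined n b\<close>] by linarith
    from G_even[OF ev gt this] show ?thesis .
  qed
  have c2: "((j_a_defined m a \<and> j_b_defined n b \<and>
        int n - 2 * int (j_b n b) < 2 * int n + 1 - 2 * int (j_a m a)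
      \<or> \<not> j_a_defined m a) \<and> Istar = 0 \<longrightarrow>
     (let d = (real n - 2 * real (j_b n b)) / (real n + 1 - 2 * real (j_b n b)) in
       (b (2 * j_b n b + 1) < 0 \<longrightarrow> for_all_suff_large (\<lambda>y0.
          escapes_nondegenerately n (orbit_seq (slow_rel F G) y0) d)) \<and>
       (b (2 * j_b n b + 1) > 0 \<longrightarrow> for_all_suff_large (\<lambda>y0.
          escapes_nondegenerately n (orbit_seq (slow_rel_inv F G) y0) d))))"
  proof (unfold Let_def, intro impI, elim conjE)
    assume *: "j_a_defined m a \<and> j_b_defined n b \<and>
        int n - 2 * int (j_b n b) < 2 * int n + 1 - 2 * int (j_a m a) \<or> \<not> j_a_defined m a" and 0: "Istar = 0"
    have jb: "j_b_defined n b" using * defined by blast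
    have lt: "j_a_defined m a \<longrightarrow> n + 2 * j_a m a < 2 * n + 1 + 2 * j_b n b" using * by linarith
    hence le: "j_a_defined m a \<longrightarrow> n + 2 * j_a m a \<le> 2 * n + 1 + 2 * j_b n b" by linarith
    have sgn: "b (2 * j_b n b + 1) * (real n + 2 * real (j_b n b) + 2) < 0 \<longleftrightarrow> b (2 * j_b n b + 1) < 0"
      "b (2 * j_b n b + 1) * (real n + 2 * real (j_b n b) + 2) > 0 \<longleftrightarrow> b (2 * j_b n b + 1) > 0"
    proof -
      have "real n + 2 * real (j_b n b) + 2 > 0" by linarith
      thus "b (2 * j_b n b + 1) * (real n + 2 * real (j_b n b) + 2) < 0 \<longleftrightarrow> b (2 * j_b n b + 1) < 0"
        "b (2 * j_b n b + 1) * (real n + 2 * real (j_b n b) + 2) > 0 \<longleftrightarrow> b (2 * j_b n b + 1) > 0"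
        by (auto simp: mult_less_0_iff zero_less_mult_iff)
    qed
    show "(b (2 * j_b n b + 1) < 0 \<longrightarrow> for_all_suff_large (\<lambda>y0.
          escapes_nondegenerately n (orbit_seq (slow_rel F G) y0)
            ((real n - 2 * real (j_b n b)) / (real n + 1 - 2 * real (j_b n b))))) \<and>
       (b (2 * j_b n b + 1) > 0 \<longrightarrow> for_all_suff_large (\<lambda>y0.
          escapes_nondegenerately n (orbit_seq (slow_rel_inv F G) y0)
            ((real n - 2 * real (j_b n b)) / (real n + 1 - 2 * real (j_b n b)))))"
      using case_b[OF jb le 0 G_top[OF jb lt, symmetric] refl]
      by (simp only: sgn mult_zero_left div_0 add_0_right)
  qed
  have c3: "((j_a_defined m a \<and> j_b_defined n b \<and>
        int n - 2 * int (j_b n b) > 2 * int n + 1 - 2 * int (j_a m a)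
      \<or> \<not> j_b_defined n b) \<and> Istar = 0 \<longrightarrow>
     (let d = (2 * real n + 1 - 2 * real (j_a m a)) / (2 * real n + 2 - 2 * real (j_a m a)) in
       (a (2 * j_a m a) > 0 \<longrightarrow> for_all_suff_large (\<lambda>y0.
          escapes_nondegenerately n (orbit_seq (slow_rel F G) y0) d)) \<and>
       (a (2 * j_a m a) < 0 \<longrightarrow> for_all_suff_large (\<lambda>y0.
          escapes_nondegenerately n (orbit_seq (slow_rel_inv F G) y0) d))))"
  proof (unfold Let_def, intro impI, elim conjE)
    assume *: "j_a_defined m a \<and> j_b_defined n b \<and>
        int n - 2 * int (j_b n b) > 2 * int n + 1 - 2 * int (j_a m a) \<or> \<not> j_b_defined n b" and 0: "Istar = 0"
    have ja: "j_a_defined m a" using * defined by blast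
    have "j_b_defined n b \<longrightarrow> n + 2 * j_a m a > 2 * n + 1 + 2 * j_b n b" using * by linarith
    from case_a[OF ja this 0 refl]
    show "(a (2 * j_a m a) > 0 \<longrightarrow> for_all_suff_large (\<lambda>y0.
          escapes_nondegenerately n (orbit_seq (slow_rel F G) y0)
            ((2 * real n + 1 - 2 * real (j_a m a)) / (2 * real n + 2 - 2 * real (j_a m a))))) \<and>
       (a (2 * j_a m a) < 0 \<longrightarrow> for_all_suff_large (\<lambda>y0.
          escapes_nondegenerately n (orbit_seq (slow_rel_inv F G) y0)
            ((2 * real n + 1 - 2 * real (j_a m a)) / (2 * real n + 2 - 2 * real (j_a m a)))))" .
  qed
  have c4: "(let C = b (2 * j_b n b + 1) * (real n + 2 * real (j_b n b) + 2)
               - a (2 * j_a m a) * ((real n + 1) / A);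
         d = (real n - 2 * real (j_b n b)) / (real n + 1 - 2 * real (j_b n b)) in
     j_a_defined m a \<and> j_b_defined n b \<and>
       int n - 2 * int (j_b n b) = 2 * int n + 1 - 2 * int (j_a m a) \<and> C \<noteq> 0 \<and> Istar = 0 \<longrightarrow>
       (C < 0 \<longrightarrow> for_all_suff_large (\<lambda>y0.
          escapes_nondegenerately n (orbit_seq (slow_rel F G) y0) d)) \<and>
       (C > 0 \<longrightarrow> for_all_suff_large (\<lambda>y0.
          escapes_nondegenerately n (orbit_seq (slow_rel_inv F G) y0) d)))"
  proof (unfold Let_def, rule impI, elim conjE)
    assume ja: "j_a_defined m a" and jb: "j_b_defined n b" and 0: "Istar = 0"
      and eq: "int n - 2 * int (j_b n b) = 2 * int n + 1 - 2 * int (j_a m a)"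
    have eq': "n + 2 * j_a m a = 2 * n + 1 + 2 * j_b n b" using eq by linarith
    have "n + 1 + 2 * j_b n b = 2 * j_a m a" using eq' by linarith
    hence \<gamma>: "- a (2 * j_a m a) = coeff G (n + 1 + 2 * j_b n b)"
      using a_def[OF ja] mn by (simp add: cG)
    have le: "j_a_defined m a \<longrightarrow> n + 2 * j_a m a \<le> 2 * n + 1 + 2 * j_b n b" using eq' by simp
    have C: "x - a (2 * j_a m a) * ((real n + 1) / A) = x + - a (2 * j_a m a) * (real n + 1) / A" for x
      by simp
    show "(b (2 * j_b n b + 1) * (real n + 2 * real (j_b n b) + 2) - a (2 * j_a m a) * ((real n + 1) / A) < 0 \<longrightarrow>
         for_all_suff_large (\<lambda>y0. escapes_nondegenerately n (orbit_seq (slow_rel F G) y0)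
            ((real n - 2 * real (j_b n b)) / (real n + 1 - 2 * real (j_b n b))))) \<and>
       (b (2 * j_b n b + 1) * (real n + 2 * real (j_b n b) + 2) - a (2 * j_a m a) * ((real n + 1) / A) > 0 \<longrightarrow>
         for_all_suff_large (\<lambda>y0. escapes_nondegenerately n (orbit_seq (slow_rel_inv F G) y0)
            ((real n - 2 * real (j_b n b)) / (real n + 1 - 2 * real (j_b n b)))))"
      using case_b[OF jb le 0 \<gamma> refl] by (simp only: C)
  qed
  show ?thesis
    using Istar escapes_dim_0[OF Istar] by (intro exI[of _ Istar] conjI c2 c3 c4 impI)
qed

end
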